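(* Let $m\in\mathbb{N}$ ($m\ge 1$) and let $\delta>-m$ be real. There is a constant $C_{m,\delta}$, depending only on $m$ and $\delta$, such that for every integer $n\ge 2$, if $W_n$ denotes the in-degree of a uniformly randomly chosen vertex of the preferential attachment random graph $G_n^{m,\delta}$ (the vertex being chosen independently of the graph), then $$d_{\mathrm{TV}}\big(\mathscr{L}(W_n),\mathrm{K}(m,\delta)\big)\le C_{m,\delta}\,\frac{\log(n)}{n}.$$
   Context: Preferential attachment graphs. For real $\varepsilon>-1$, the random graphs $G_k^{1,\varepsilon}$, $k=1,2,\ldots$, are built recursively. $G_1^{1,\varepsilon}$ has one vertex, labelled $1$, with a single loop; one end of the loop contributes $1$ to the in-degree and the other end contributes $1$ to the out-degree. For $k\ge 2$, given $G_{k-1}^{1,\varepsilon}$, add vertex $k$ together with one edge going out of $k$ and into a random vertex chosen from $\{1,\ldots,k\}$ with probability proportional to (total degree of that vertex) $+\,\varepsilon$, where total degree is in-degree plus out-degree and vertex $k$ is initially regarded as having degree one. Thus, given $G_{k-1}^{1,\varepsilon}$, vertex $k$ connects to $j<k$ with probability $(\text{in-degree of } j + 1+\varepsilon)/(k(2+\varepsilon)-1)$ and to itself with probability $(1+\varepsilon)/(k(2+\varepsilon)-1)$. For $m=1$, $G_n^{1,\delta}$ is this graph with $\varepsilon=\delta$. For $m>1$ and $\delta>-m$, $G_n^{m,\delta}$ is obtained by generating $G_{nm}^{1,\delta/m}$ and collapsing consecutive vertices into groups of size $m$: vertex $i\in\{1,\ldots,n\}$ of $G_n^{m,\delta}$ is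 the group $\{m(i-1)+1,\ldots,mi\}$, and all edges are retained (loops and multiple edges are allowed and all count toward in- and out-degrees). Negative binomial: for $r>0$, $0<p\le 1$, $X\sim\mathrm{NB}(r,p)$ means $\mathbb{P}(X=k)=\frac{\Gamma(r+k)}{k!\,\Gamma(r)}(1-p)^kp^r$, $k=0,1,\ldots$. $\mathrm{K}(m,\delta)$ is the mixture distribution $\mathrm{NB}(m+\delta,U^{1/(2+\delta/m)})$ with $U$ uniform on $(0,1)$, i.e. conditionally on $U$ the variable has law $\mathrm{NB}(m+\delta,U^{1/(2+\delta/m)})$. $\mathscr{L}(X)$ is the law of $X$. For distributions of non-negative integer valued random variables $X,Y$, $d_{\mathrm{TV}}(\mathscr{L}(X),\mathscr{L}(Y))=\sup_{A\subseteq\{0,1,\ldots\}}|\mathbb{P}(X\in A)-\mathbb{P}(Y\in A)|$. *)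

theory Defs
  imports "HOL-Probability.Probability" "Graph_Theory.Digraph"
begin

text \<open>
  All graphs are directed multigraphs. The arc leaving vertex \<open>k\<close> of the tree-like
  graph (the case of one edge per vertex) is itself named \<open>k\<close>.
\<close>

type_synonym multigraph = "(nat, nat) pre_digraph"

subsection \<open>One edge per vertex\<close>

definition pa_init :: multigraph where
  "pa_init = \<lparr>verts = {1}, arcs = {1}, tail = (\<lambda>_. 1), head = (\<lambda>_. 1)\<rparr>"

text \<open>
  \<open>G\<close> is the graph on \<open>1, \<dots>, k - 1\<close>. The new vertex \<open>k\<close> already counts with degree one,
  the out-going end of its own edge.
\<close>

definition pa_weight :: "real \<Rightarrow> multigraph \<Rightarrow> nat \<Rightarrow> nat \<Rightarrow> real" where
  "pa_weight \<epsilon> G k j = (if j = k then 1 else real (in_degree G j + out_degree G j)) + \<epsilon>"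

definition pa_target :: "real \<Rightarrow> multigraph \<Rightarrow> nat \<Rightarrow> nat pmf" where
  "pa_target \<epsilon> G k = embed_pmf (\<lambda>j. if j \<in> {1..k}
     then pa_weight \<epsilon> G k j / (\<Sum>i\<in>{1..k}. pa_weight \<epsilon> G k i) else 0)"

definition pa_extend :: "multigraph \<Rightarrow> nat \<Rightarrow> nat \<Rightarrow> multigraph" where
  "pa_extend G k j = \<lparr>verts = insert k (verts G), arcs = insert k (arcs G),
     tail = (tail G)(k := k), head = (head G)(k := j)\<rparr>"

text \<open>The construction starts at \<open>k = 1\<close>; the value at \<open>0\<close> is a dummy.\<close>

fun pa_tree :: "real \<Rightarrow> nat \<Rightarrow> multigraph pmf" where
  "pa_tree \<epsilon> 0 = return_pmf \<lparr>verts = {}, arcs = {}, tail = (\<lambda>_. 1), head = (\<lambda>_. 1)\<rparr>"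
| "pa_tree \<epsilon> (Suc 0) = return_pmf pa_init"
| "pa_tree \<epsilon> (Suc (Suc k)) = do {
     G \<leftarrow> pa_tree \<epsilon> (Suc k);
     j \<leftarrow> pa_target \<epsilon> G (Suc (Suc k));
     return_pmf (pa_extend G (Suc (Suc k)) j)
   }"

subsection \<open>Collapsing groups of \<open>m\<close> consecutive vertices\<close>

text \<open>\<open>group_index m v\<close> is \<open>v / m\<close> rounded up.\<close>

definition group_index :: "nat \<Rightarrow> nat \<Rightarrow> nat" where
  "group_index m v = (v + m - 1) div m"

lemma group_index_eq_iff:
  assumes "m \<ge> 1" "i \<ge> 1"
  shows "group_index m v = i \<longleftrightarrow> v \<in> {m * (i - 1) + 1..m * i}"
proof -
  obtain l where i: "i = Suc l" using assms(2) by (cases i) auto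
  have "group_index m v = i \<longleftrightarrow> i * m \<le> v + m - 1 \<and> v + m - 1 < Suc i * m"
    unfolding group_index_def using assms(1)
    by (metis One_nat_def Suc_le_lessD div_nat_eqI dividend_less_times_div div_times_less_eq_dividend
        mult.commute mult_Suc_right add.commute mult_Suc)
  then show ?thesis using assms unfolding i by (auto simp: algebra_simps)
qed

definition collapse :: "nat \<Rightarrow> multigraph \<Rightarrow> multigraph" where
  "collapse m G = \<lparr>verts = group_index m ` verts G, arcs = arcs G,
     tail = group_index m \<circ> tail G, head = group_index m \<circ> head G\<rparr>"

lemma collapse_1: "collapse 1 G = G"
  by (simp add: collapse_def group_index_def o_def)

definition pa_graph :: "nat \<Rightarrow> real \<Rightarrow> nat \<Rightarrow> multigraph pmf" where
  "pa_graph m \<delta> n = map_pmf (collapse m) (pa_tree (\<delta> / real m) (n * m))"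

lemma pa_graph_1: "pa_graph 1 \<delta> n = pa_tree \<delta> n"
proof -
  have "collapse 1 = (\<lambda>G. G)" by (rule ext) (rule collapse_1)
  then show ?thesis by (simp add: pa_graph_def)
qed

definition indegree_law :: "nat \<Rightarrow> real \<Rightarrow> nat \<Rightarrow> nat pmf" where
  "indegree_law m \<delta> n =
     map_pmf (\<lambda>(G, v). in_degree G v) (pair_pmf (pa_graph m \<delta> n) (pmf_of_set {1..n}))"

subsection \<open>The limiting distribution\<close>

text \<open>The library's negative binomial distribution only has integer shape parameters.\<close>

definition nb_pmf :: "real \<Rightarrow> real \<Rightarrow> nat pmf" where
  "nb_pmf r p = embed_pmf (\<lambda>k. Gamma (r + real k) / (fact k * Gamma r) * (1 - p) ^ k * p powr r)"

text \<open>
  Restricting Lebesgue measure to the open unit interval gives the law of a uniform random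
  variable whose values are all admissible parameters for \<^const>\<open>nb_pmf\<close>.
\<close>

definition K_dist :: "nat \<Rightarrow> real \<Rightarrow> nat measure" where
  "K_dist m \<delta> = restrict_space lborel {0<..<1} \<bind>
     (\<lambda>u. measure_pmf (nb_pmf (real m + \<delta>) (u powr (1 / (2 + \<delta> / real m)))))"

definition dTV :: "nat measure \<Rightarrow> nat measure \<Rightarrow> real" where
  "dTV M N = (SUP A. \<bar>measure M A - measure N A\<bar>)"

subsection \<open>The distributions above are well defined\<close>

text \<open>
  The constant \<^const>\<open>embed_pmf\<close> is only meaningful for non-negative functions of total mass
  one, and monadic bind on measures only for measurable kernels. Both conditions hold in
  every case used here.
\<close>

lemma pmf_proportional:
  fixes w :: "'a \<Rightarrow> real"
  assumes "finite S" "S \<noteq> {}" "\<And>x. x \<in> S \<Longrightarrow> w x > 0"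
  shows "pmf (embed_pmf (\<lambda>x. if x \<in> S then w x / (\<Sum>y\<in>S. w y) else 0)) x
           = (if x \<in> S then w x / (\<Sum>y\<in>S. w y) else 0)"
proof (rule pmf_embed_pmf)
  have pos: "(\<Sum>y\<in>S. w y) > 0" using assms by (intro sum_pos) auto
  show nn: "0 \<le> (if x \<in> S then w x / (\<Sum>y\<in>S. w y) else 0)" for x
    using pos assms(3)[of x] by (auto intro!: divide_nonneg_pos less_imp_le)
  have "(\<integral>\<^sup>+x. ennreal (if x \<in> S then w x / (\<Sum>y\<in>S. w y) else 0) \<partial>count_space UNIV)
          = (\<Sum>x\<in>S. ennreal (if x \<in> S then w x / (\<Sum>y\<in>S. w y) else 0))"
    using assms(1) by (intro nn_integral_count_space') auto
  also have "\<dots> = ennreal (\<Sum>x\<in>S. if x \<in> S then w x / (\<Sum>y\<in>S. w y) else 0)"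
    by (intro sum_ennreal nn)
  also have "(\<Sum>x\<in>S. if x \<in> S then w x / (\<Sum>y\<in>S. w y) else 0) = (\<Sum>x\<in>S. w x / (\<Sum>y\<in>S. w y))"
    by (intro sum.cong) auto
  also have "\<dots> = 1" using pos by (simp flip: sum_divide_distrib)
  finally show "(\<integral>\<^sup>+x. ennreal (if x \<in> S then w x / (\<Sum>y\<in>S. w y) else 0) \<partial>count_space UNIV) = 1"
    by simp
qed

definition tree_shaped :: "nat \<Rightarrow> multigraph \<Rightarrow> bool" where
  "tree_shaped k G \<longleftrightarrow> verts G = {1..k} \<and> arcs G = {1..k}
     \<and> (\<forall>e\<in>{1..k}. tail G e = e \<and> head G e \<in> {1..k})"

lemma out_degree_tree_shaped:
  assumes "tree_shaped k G" "j \<in> {1..k}"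
  shows "out_degree G j = 1"
proof -
  have "out_arcs G j = {j}"
    using assms by (auto simp: tree_shaped_def out_arcs_def)
  then show ?thesis by (simp add: out_degree_def)
qed

lemma sum_in_degree_tree_shaped:
  assumes "tree_shaped k G"
  shows "(\<Sum>j\<in>{1..k}. in_degree G j) = k"
proof -
  have "(\<Sum>j\<in>{1..k}. in_degree G j) = (\<Sum>j\<in>{1..k}. card {e \<in> {1..k}. head G e = j})"
    using assms by (intro sum.cong) (auto simp: in_degree_def in_arcs_def tree_shaped_def)
  also have "\<dots> = card (\<Union>j\<in>{1..k}. {e \<in> {1..k}. head G e = j})"
    by (intro card_UN_disjoint [symmetric]) auto
  also have "(\<Union>j\<in>{1..k}. {e \<in> {1..k}. head G e = j}) = {1..k}"
    using assms by (auto simp: tree_shaped_def)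
  finally show ?thesis by simp
qed

lemma pmf_pa_target_aux:
  assumes "\<epsilon> > -1" "tree_shaped k G"
  shows "pmf (pa_target \<epsilon> G (Suc k)) j = (if j \<in> {1..Suc k}
           then pa_weight \<epsilon> G (Suc k) j / (real (Suc k) * (2 + \<epsilon>) - 1) else 0)"
proof -
  have w: "pa_weight \<epsilon> G (Suc k) i = real (in_degree G i) + 1 + \<epsilon>" if "i \<in> {1..k}" for i
    using that out_degree_tree_shaped[OF assms(2) that] by (auto simp: pa_weight_def)
  have pos: "pa_weight \<epsilon> G (Suc k) i > 0" if "i \<in> {1..Suc k}" for i
  proof (cases "i = Suc k")
    case False
    then have "i \<in> {1..k}" using that by auto
    from w[OF this] show ?thesis using assms(1) by linarith
  qed (use assms(1) in \<open>simp add: pa_weight_def\<close>)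
  have "(\<Sum>i\<in>{1..Suc k}. pa_weight \<epsilon> G (Suc k) i)
          = (\<Sum>i\<in>{1..k}. real (in_degree G i) + 1 + \<epsilon>) + (1 + \<epsilon>)"
  proof -
    have "(\<Sum>i\<in>{1..k}. pa_weight \<epsilon> G (Suc k) i) = (\<Sum>i\<in>{1..k}. real (in_degree G i) + 1 + \<epsilon>)"
      by (intro sum.cong refl w)
    then show ?thesis by (simp add: pa_weight_def[of _ _ "Suc k" "Suc k"])
  qed
  also have "\<dots> = real (\<Sum>i\<in>{1..k}. in_degree G i) + real k * (1 + \<epsilon>) + (1 + \<epsilon>)"
    by (simp add: sum.distrib algebra_simps)
  also have "\<dots> = real (Suc k) * (2 + \<epsilon>) - 1"
    unfolding sum_in_degree_tree_shaped[OF assms(2)] by (simp add: algebra_simps)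
  finally have s: "(\<Sum>i\<in>{1..Suc k}. pa_weight \<epsilon> G (Suc k) i) = real (Suc k) * (2 + \<epsilon>) - 1" .
  have "pmf (pa_target \<epsilon> G (Suc k)) j = (if j \<in> {1..Suc k}
      then pa_weight \<epsilon> G (Suc k) j / (\<Sum>i\<in>{1..Suc k}. pa_weight \<epsilon> G (Suc k) i) else 0)"
    unfolding pa_target_def using pos by (intro pmf_proportional) auto
  then show ?thesis unfolding s .
qed

lemma tree_shaped_pa_tree:
  assumes "\<epsilon> > -1" "k \<ge> 1" "G \<in> set_pmf (pa_tree \<epsilon> k)"
  shows "tree_shaped k G"
  using assms
proof (induction \<epsilon> k arbitrary: G rule: pa_tree.induct)
  case (3 \<epsilon> k)
  then obtain H j where H: "H \<in> set_pmf (pa_tree \<epsilon> (Suc k))"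
    and j: "j \<in> set_pmf (pa_target \<epsilon> H (Suc (Suc k)))" and G: "G = pa_extend H (Suc (Suc k)) j"
    by auto
  have ts: "tree_shaped (Suc k) H" using 3 H by auto
  have "j \<in> {1..Suc (Suc k)}"
    using j pmf_pa_target_aux[OF "3.prems"(1) ts, of j] by (auto simp: set_pmf_iff split: if_splits)
  then show ?case using ts unfolding G
    by (auto simp: tree_shaped_def pa_extend_def le_Suc_eq)
qed (auto simp: tree_shaped_def pa_init_def)

lemma pmf_pa_target:
  assumes "\<epsilon> > -1" "k \<ge> 2" "G \<in> set_pmf (pa_tree \<epsilon> (k - 1))"
  shows "j \<in> {1..<k} \<Longrightarrow> pmf (pa_target \<epsilon> G k) j
           = (real (in_degree G j) + 1 + \<epsilon>) / (real k * (2 + \<epsilon>) - 1)"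
    and "pmf (pa_target \<epsilon> G k) k = (1 + \<epsilon>) / (real k * (2 + \<epsilon>) - 1)"
proof -
  obtain l where k: "k = Suc l" using assms(2) by (cases k) auto
  have ts: "tree_shaped l G" using tree_shaped_pa_tree[of \<epsilon> l G] assms k by auto
  note target = pmf_pa_target_aux[OF assms(1) ts]
  show "pmf (pa_target \<epsilon> G k) j = (real (in_degree G j) + 1 + \<epsilon>) / (real k * (2 + \<epsilon>) - 1)"
    if "j \<in> {1..<k}"
    using that out_degree_tree_shaped[OF ts, of j] target[of j] by (auto simp: k pa_weight_def)
  show "pmf (pa_target \<epsilon> G k) k = (1 + \<epsilon>) / (real k * (2 + \<epsilon>) - 1)"
    using target[of k] by (auto simp: k pa_weight_def)
qed

lemma pmf_nb:
  assumes "r > 0" "0 < p" "p \<le> 1"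
  shows "pmf (nb_pmf r p) k = Gamma (r + real k) / (fact k * Gamma r) * (1 - p) ^ k * p powr r"
  unfolding nb_pmf_def
proof (rule pmf_embed_pmf)
  let ?f = "\<lambda>k. Gamma (r + real k) / (fact k * Gamma r) * (1 - p) ^ k * p powr r"
  have r: "r \<notin> \<int>\<^sub>\<le>\<^sub>0" using assms(1) nonpos_Ints_nonpos[of r] by auto
  show nn: "0 \<le> ?f k" for k
    using assms by (intro mult_nonneg_nonneg divide_nonneg_nonneg less_imp_le[OF Gamma_real_pos]) auto
  have "(\<lambda>k. ((- r) gchoose k) * (p - 1) ^ k) sums (1 + (p - 1)) powr (- r)"
    using assms by (intro gen_binomial_real) auto
  from sums_mult2[OF this, of "p powr r"]
  have "(\<lambda>k. ((- r) gchoose k) * (p - 1) ^ k * p powr r) sums 1"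
    using assms(2) by (simp flip: powr_add)
  also have "(\<lambda>k. ((- r) gchoose k) * (p - 1) ^ k * p powr r) = ?f"
  proof
    fix k
    have "((- r) gchoose k) * (p - 1) ^ k = pochhammer r k / fact k * ((- 1) ^ k * (p - 1) ^ k)"
      by (simp add: gbinomial_pochhammer)
    also have "(- 1) ^ k * (p - 1) ^ k = (1 - p) ^ k"
      by (simp flip: power_mult_distrib)
    finally show "((- r) gchoose k) * (p - 1) ^ k * p powr r = ?f k"
      using pochhammer_Gamma[OF r, of k] by (simp add: field_simps)
  qed
  finally have s: "?f sums 1" .
  have "(\<integral>\<^sup>+k. ennreal (?f k) \<partial>count_space UNIV) = (\<Sum>k. ennreal (?f k))"
    by (rule nn_integral_count_space_nat)
  also have "\<dots> = ennreal (\<Sum>k. ?f k)"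
    using s nn by (intro suminf_ennreal2) (auto simp: sums_iff)
  finally show "(\<integral>\<^sup>+k. ennreal (?f k) \<partial>count_space UNIV) = 1"
    using s by (simp add: sums_iff)
qed

lemma K_dist_parameter:
  assumes "m \<ge> 1" "\<delta> > - real m" "u \<in> {0<..<1}"
  shows "0 < u powr (1 / (2 + \<delta> / real m))" "u powr (1 / (2 + \<delta> / real m)) \<le> 1"
proof -
  have "\<delta> / real m > -1" using assms by (simp add: field_simps)
  then show "0 < u powr (1 / (2 + \<delta> / real m))" "u powr (1 / (2 + \<delta> / real m)) \<le> 1"
    using assms(3) by (auto intro!: powr_le1)
qed

lemma
  assumes "m \<ge> 1" "\<delta> > - real m"
  shows prob_space_K_dist: "prob_space (K_dist m \<delta>)"
    and sets_K_dist: "sets (K_dist m \<delta>) = UNIV"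
    and measure_K_dist: "measure (K_dist m \<delta>) A = (LINT u:{0<..<1}|lborel.
           measure_pmf.prob (nb_pmf (real m + \<delta>) (u powr (1 / (2 + \<delta> / real m)))) A)"
proof -
  let ?U = "restrict_space lborel {0<..<(1::real)}"
  let ?K = "\<lambda>u. nb_pmf (real m + \<delta>) (u powr (1 / (2 + \<delta> / real m)))"
  interpret U: prob_space ?U
    by (rule prob_spaceI) (simp add: emeasure_restrict_space space_restrict_space)
  have [measurable]: "(\<lambda>u. pmf (?K u) k) \<in> borel_measurable ?U" for k
  proof -
    let ?p = "\<lambda>u::real. u powr (1 / (2 + \<delta> / real m))"
    have "(\<lambda>u. pmf (?K u) k) \<in> borel_measurable ?U \<longleftrightarrow>
      (\<lambda>u. Gamma (real m + \<delta> + real k) / (fact k * Gamma (real m + \<delta>)) *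
         (1 - ?p u) ^ k * ?p u powr (real m + \<delta>)) \<in> borel_measurable ?U"
      using assms K_dist_parameter[OF assms]
      by (intro measurable_cong pmf_nb) (auto simp: space_restrict_space)
    also have "\<dots>" by (intro measurable_restrict_space1) measurable
    finally show ?thesis .
  qed
  have K: "(\<lambda>u. measure_pmf (?K u)) \<in> measurable ?U (subprob_algebra (count_space UNIV))"
  proof (rule measurable_subprob_algebra)
    fix A :: "nat set"
    have "emeasure (measure_pmf (?K u)) A = (\<Sum>k. ennreal (pmf (?K u) k) * indicator A k)" for u
      by (subst measure_pmf_eq_density)
        (simp add: emeasure_density nn_integral_count_space_nat)
    then show "(\<lambda>u. emeasure (measure_pmf (?K u)) A) \<in> borel_measurable ?U" by simp
  qed (auto intro: measure_pmf.subprob_space_axioms)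
  show "prob_space (K_dist m \<delta>)"
    unfolding K_dist_def using K
    by (rule U.prob_space_bind[rotated]) (auto intro: measure_pmf.prob_space_axioms)
  show "sets (K_dist m \<delta>) = UNIV"
    unfolding K_dist_def using U.not_empty by (subst sets_bind[where N="count_space UNIV"]) auto
  show "measure (K_dist m \<delta>) A =
      (LINT u:{0<..<1}|lborel. measure_pmf.prob (?K u) A)"
    unfolding K_dist_def set_lebesgue_integral_def
    by (subst U.measure_bind[OF K]) (auto simp: integral_restrict_space)
qed

end

theory Submission
  imports Defs
begin

text \<open>
  Write \<open>\<epsilon> = \<delta> / m\<close>, \<open>r = m + \<delta> = m (1 + \<epsilon>)\<close> and \<open>\<beta> = 2 + \<epsilon>\<close>. Once all \<open>m\<close> members of a group are
  present, the group receives the edge of vertex \<open>t\<close> with probability \<open>a\<^sub>t (r + d)\<close>, where \<open>d\<close> is its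
  in-degree and \<open>a\<^sub>t = 1 / (t \<beta> - 1)\<close>. So its in-degree is a pure birth chain, and the forward equation
  for its law \<open>q\<close> is \<open>q\<^sub>t = q\<^bsub>t-1\<^esub> + a\<^sub>t L q\<^bsub>t-1\<^esub>\<close> with
  \<open>L f k = (r + k - 1) f (k - 1) - (r + k) f k\<close>. Let \<open>\<delta>\<^sub>0\<close> be the unit mass at \<open>0\<close>, and let
  \<open>F\<^sub>t\<close> be the sum of these laws over the vertices
  \<open>v \<le> t\<close>, each taken for the group of \<open>v\<close>, divided by \<open>m\<close>; at \<open>t = n m\<close> it is \<open>n\<close> times the law of
  \<open>W\<^sub>n\<close>. Every new vertex adds mass \<open>1 / m\<close>, almost all of it at \<open>0\<close>, so
  \<open>F\<^sub>t = F\<^bsub>t-1\<^esub> + a\<^sub>t L F\<^bsub>t-1\<^esub> + \<delta>\<^sub>0 / m\<close> up to an \<open>\<ell>\<^sup>1\<close> error of order \<open>1 / t\<close>, which comes from the one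
  incomplete group (\<open>mean_count_Suc\<close>).

  The point masses \<open>p\<close> of the limit law satisfy \<open>L p = \<beta> (p - \<delta>\<^sub>0)\<close> (\<open>K_dist_stationary\<close>), which says
  that \<open>(t / m) p\<close> solves the same recursion up to an error of order \<open>1 / t\<close>. The equation holds because
  \<open>u d/du\<close>, applied to the negative binomial masses with parameter \<open>u\<^bsup>1/\<beta>\<^esup>\<close>, is \<open>- L / \<beta>\<close>; integrate
  over \<open>u\<close>.

  The difference \<open>e\<^sub>t = F\<^sub>t - (t / m) p\<close> therefore satisfies \<open>e\<^sub>t = (I + a\<^sub>t L) e\<^bsub>t-1\<^esub> + O(1 / t)\<close>. On degrees
  below \<open>t\<close> the matrix \<open>I + a\<^sub>t L\<close> has non-negative entries and column sums at most one, hence does not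
  increase the \<open>\<ell>\<^sup>1\<close> norm (\<open>birth_step_l1\<close>); raising the cut-off from \<open>t - 1\<close> to \<open>t\<close> costs at most a
  constant times \<open>t p t\<close>, which is summable since \<open>p\<close> has a finite mean (\<open>stationary_tail_and_mean\<close>).
  Summing the steps gives \<open>\<parallel>e\<^sub>t\<parallel> = O(log t)\<close> (\<open>error_log_bound\<close>). Dividing by \<open>n\<close> at \<open>t = n m\<close> bounds the
  distance on \<open>{..n m}\<close>, and the mass of the limit law beyond \<open>n m\<close> is \<open>O(1 / n)\<close>, again by the finite mean.
\<close>

section \<open>The forward operator of a linear birth chain\<close>

text \<open>
  The right-hand side of Kolmogorov's forward equation for the pure birth chain with rate \<open>r + k\<close> in
  state \<open>k\<close>.
\<close>

definition birth_op :: "real \<Rightarrow> (nat \<Rightarrow> real) \<Rightarrow> nat \<Rightarrow> real" where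
  "birth_op r f k = (case k of 0 \<Rightarrow> 0 | Suc j \<Rightarrow> (r + real j) * f j) - (r + real k) * f k"

text \<open>
  The operator only moves mass upwards, so the sum telescopes to minus the flow from \<open>n\<close> to \<open>n + 1\<close>.
\<close>

lemma sum_birth_op: "(\<Sum>k\<le>n. birth_op r f k) = - (r + real n) * f n"
  by (induction n) (simp_all add: birth_op_def algebra_simps)

lemma birth_op_linear:
  "birth_op r (\<lambda>k. c * f k - d * h k) k = c * birth_op r f k - d * birth_op r h k"
  by (cases k) (simp_all add: birth_op_def algebra_simps)

lemma birth_op_sum:
  "birth_op r (\<lambda>k. (\<Sum>v\<in>V. f v k) / c) k = (\<Sum>v\<in>V. birth_op r (f v) k) / c"
proof -
  have "(\<Sum>v\<in>V. birth_op r (f v) k) = birth_op r (\<lambda>k. \<Sum>v\<in>V. f v k) k"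
    by (cases k) (simp_all only: birth_op_def nat.case sum_subtractf sum_distrib_left sum.neutral_const)
  then show ?thesis
    by (cases k) (simp_all add: birth_op_def diff_divide_distrib)
qed

text \<open>
  The mass that leaves a state \<open>k \<le> n\<close> arrives at \<open>k + 1 \<le> n + 1\<close>, and \<open>a (r + n) \<le> 1\<close> keeps the
  remaining part non-negative; so the states up to \<open>n\<close> contribute at most their own norm. In state
  \<open>n + 1\<close> the coefficient may be negative, and this state is kept as a separate term.
\<close>

lemma birth_step_l1:
  assumes "a \<ge> 0" "r \<ge> 0" "a * (r + real n) \<le> 1"
  shows "(\<Sum>k\<le>Suc n. \<bar>f k + a * birth_op r f k\<bar>)
    \<le> (\<Sum>k\<le>n. \<bar>f k\<bar>) + \<bar>1 - a * (r + real (Suc n))\<bar> * \<bar>f (Suc n)\<bar>"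
proof -
  \<comment> \<open>The mass that \<open>\<bar>f\<bar>\<close> sends into state \<open>k\<close>.\<close>
  define inflow where "inflow k = (case k of 0 \<Rightarrow> 0 | Suc j \<Rightarrow> (r + real j) * \<bar>f j\<bar>)" for k
  have "\<bar>f k + a * birth_op r f k\<bar> \<le> a * inflow k + \<bar>1 - a * (r + real k)\<bar> * \<bar>f k\<bar>" for k
  proof -
    have "f k + a * birth_op r f k
        = a * (case k of 0 \<Rightarrow> 0 | Suc j \<Rightarrow> (r + real j) * f j) + (1 - a * (r + real k)) * f k"
      by (simp add: birth_op_def algebra_simps)
    also have "\<bar>\<dots>\<bar> \<le> \<bar>a * (case k of 0 \<Rightarrow> 0 | Suc j \<Rightarrow> (r + real j) * f j)\<bar>
        + \<bar>(1 - a * (r + real k)) * f k\<bar>" by (rule abs_triangle_ineq)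
    also have "\<bar>a * (case k of 0 \<Rightarrow> 0 | Suc j \<Rightarrow> (r + real j) * f j)\<bar> = a * inflow k"
      using assms by (simp add: inflow_def abs_mult split: nat.split)
    finally show ?thesis by (simp add: abs_mult)
  qed
  then have "(\<Sum>k\<le>Suc n. \<bar>f k + a * birth_op r f k\<bar>)
      \<le> (\<Sum>k\<le>Suc n. a * inflow k + \<bar>1 - a * (r + real k)\<bar> * \<bar>f k\<bar>)"
    by (intro sum_mono)
  also have "\<dots> = a * (\<Sum>k\<le>Suc n. inflow k) + (\<Sum>k\<le>n. \<bar>1 - a * (r + real k)\<bar> * \<bar>f k\<bar>)
      + \<bar>1 - a * (r + real (Suc n))\<bar> * \<bar>f (Suc n)\<bar>"
    by (simp add: sum.distrib sum_distrib_left distrib_left)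
  also have "(\<Sum>k\<le>n. \<bar>1 - a * (r + real k)\<bar> * \<bar>f k\<bar>) = (\<Sum>k\<le>n. (1 - a * (r + real k)) * \<bar>f k\<bar>)"
  proof (intro sum.cong refl)
    fix k assume "k \<in> {..n}"
    then have "a * (r + real k) \<le> a * (r + real n)" using assms by (intro mult_left_mono) auto
    then show "\<bar>1 - a * (r + real k)\<bar> * \<bar>f k\<bar> = (1 - a * (r + real k)) * \<bar>f k\<bar>"
      using assms by simp
  qed
  also have "(\<Sum>k\<le>Suc n. inflow k) = (\<Sum>k\<le>n. (r + real k) * \<bar>f k\<bar>)"
    unfolding sum.atMost_Suc_shift by (simp add: inflow_def)
  also have "a * (\<Sum>k\<le>n. (r + real k) * \<bar>f k\<bar>) + (\<Sum>k\<le>n. (1 - a * (r + real k)) * \<bar>f k\<bar>)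
      = (\<Sum>k\<le>n. \<bar>f k\<bar>)"
    by (simp add: sum_distrib_left sum.distrib[symmetric] algebra_simps)
  finally show ?thesis .
qed

text \<open>
  Used for incomplete groups, whose shape \<open>r\<close> is smaller than that of complete ones.
\<close>

lemma birth_op_shape_l1:
  assumes "\<And>k. f k \<ge> 0" "(\<Sum>k\<le>n. f k) \<le> 1"
  shows "(\<Sum>k\<le>n. \<bar>birth_op r f k - birth_op s f k\<bar>) \<le> 2 * \<bar>r - s\<bar>"
proof -
  have "\<bar>birth_op r f k - birth_op s f k\<bar> \<le> \<bar>r - s\<bar> * ((case k of 0 \<Rightarrow> 0 | Suc j \<Rightarrow> f j) + f k)" for k
  proof -
    have "birth_op r f k - birth_op s f k = (r - s) * ((case k of 0 \<Rightarrow> 0 | Suc j \<Rightarrow> f j) - f k)"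
      by (simp add: birth_op_def algebra_simps split: nat.split)
    moreover have "\<bar>(case k of 0 \<Rightarrow> 0 | Suc j \<Rightarrow> f j) - f k\<bar> \<le> (case k of 0 \<Rightarrow> 0 | Suc j \<Rightarrow> f j) + f k"
      using assms(1) by (cases k) (auto simp: abs_le_iff add_increasing add_increasing2)
    ultimately show ?thesis by (simp add: abs_mult mult_left_mono)
  qed
  then have "(\<Sum>k\<le>n. \<bar>birth_op r f k - birth_op s f k\<bar>)
      \<le> (\<Sum>k\<le>n. \<bar>r - s\<bar> * ((case k of 0 \<Rightarrow> 0 | Suc j \<Rightarrow> f j) + f k))"
    by (intro sum_mono)
  also have "\<dots> = \<bar>r - s\<bar> * ((\<Sum>k\<le>n. case k of 0 \<Rightarrow> 0 | Suc j \<Rightarrow> f j) + (\<Sum>k\<le>n. f k))"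
    unfolding sum_distrib_left[symmetric] sum.distrib ..
  also have "(\<Sum>k\<le>n. case k of 0 \<Rightarrow> 0 | Suc j \<Rightarrow> f j) \<le> (\<Sum>k\<le>n. f k)"
    using assms(1) by (cases n) (simp_all add: sum.atMost_Suc_shift del: sum.atMost_Suc,
      simp add: sum.atMost_Suc_shift[symmetric] del: sum.atMost_Suc, simp)
  also have "\<bar>r - s\<bar> * ((\<Sum>k\<le>n. f k) + (\<Sum>k\<le>n. f k)) \<le> \<bar>r - s\<bar> * (1 + 1)"
    using assms(2) by (intro mult_left_mono) auto
  finally show ?thesis by (simp add: mult_left_mono)
qed

text \<open>
  Summing the stationary equation up to \<open>n\<close> identifies the tail \<open>T n = 1 - (\<Sum>k\<le>n. p k)\<close> as
  \<open>(r + n) p n / \<beta>\<close>, which is non-negative. Summing these tails gives both the truncated mean plus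
  \<open>(n + 1) T n\<close> (summation by parts) and at most \<open>(r + mean) / \<beta>\<close>; since \<open>\<beta> > 1\<close> the mean can be
  absorbed. The second claim thus bounds the mean and the tail at once.
\<close>

lemma stationary_tail_and_mean:
  assumes "\<beta> > 1" "r > 0" "\<And>k. p k \<ge> 0"
    and stat: "\<And>k. birth_op r p k = \<beta> * (p k - of_bool (k = 0))"
  shows "(\<Sum>k\<le>n. p k) \<le> 1"
    and "(\<beta> - 1) * (\<Sum>k\<le>n. real k * p k) + \<beta> * (real n + 1) * (1 - (\<Sum>k\<le>n. p k)) \<le> r"
proof -
  define T where "T n = 1 - (\<Sum>k\<le>n. p k)" for n
  have T: "\<beta> * T n = (r + real n) * p n" for n
  proof -
    have "(\<Sum>k\<le>n. birth_op r p k) = \<beta> * ((\<Sum>k\<le>n. p k) - 1)"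
      unfolding stat by (simp add: sum_distrib_left[symmetric] sum_subtractf)
    then show ?thesis unfolding sum_birth_op T_def by (simp add: algebra_simps)
  qed
  have "T n \<ge> 0"
    using T[of n] assms by (metis add_nonneg_nonneg less_imp_le mult_nonneg_nonneg of_nat_0_le_iff
        zero_le_mult_iff not_less order_less_trans zero_less_one)
  then show "(\<Sum>k\<le>n. p k) \<le> 1" by (simp add: T_def)
  have parts: "(\<Sum>k\<le>n. real k * p k) + (real n + 1) * T n = (\<Sum>k\<le>n. T k)"
    by (induction n) (simp_all add: T_def algebra_simps)
  have "\<beta> * (\<Sum>k\<le>n. T k) = (\<Sum>k\<le>n. (r + real k) * p k)"
    unfolding sum_distrib_left T ..
  also have "\<dots> = r * (1 - T n) + (\<Sum>k\<le>n. real k * p k)"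
    by (simp add: T_def sum.distrib sum_distrib_left algebra_simps)
  also have "\<dots> \<le> r + (\<Sum>k\<le>n. real k * p k)"
    using \<open>T n \<ge> 0\<close> assms(2) by (simp add: algebra_simps)
  finally show "(\<beta> - 1) * (\<Sum>k\<le>n. real k * p k) + \<beta> * (real n + 1) * (1 - (\<Sum>k\<le>n. p k)) \<le> r"
    unfolding parts[symmetric] T_def[of n] by (simp add: algebra_simps)
qed

section \<open>Stationarity of the mixed negative binomial law\<close>

text \<open>
  The formula for the negative binomial masses, extended to all real \<open>q\<close>: it vanishes at \<open>q = 0\<close>,
  where the distribution itself makes no sense, so the fundamental theorem of calculus applies on the
  closed unit interval.
\<close>

definition nb_mass :: "real \<Rightarrow> nat \<Rightarrow> real \<Rightarrow> real" where
  "nb_mass r k q = Gamma (r + real k) / (fact k * Gamma r) * (1 - q) ^ k * q powr r"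

text \<open>
  Lowering the success probability moves mass upwards exactly like the birth chain does: with
  \<open>c\<^sub>k = \<Gamma>(r + k) / (k! \<Gamma>(r))\<close> one has \<open>(r + k) c\<^sub>k = (k + 1) c\<^bsub>k+1\<^esub>\<close>, and the derivative of \<open>(1 - q)\<^sup>k\<close>
  is an inflow from \<open>k - 1\<close>.
\<close>

lemma nb_mass_has_derivative:
  assumes "r > 0" "q > 0"
  shows "(nb_mass r k has_real_derivative - birth_op r (\<lambda>j. nb_mass r j q) k / q) (at q)"
proof (cases k)
  case 0
  have "nb_mass r 0 = (\<lambda>q. q powr r)"
    using Gamma_real_pos[OF assms(1)] by (auto simp: nb_mass_def)
  moreover have "((\<lambda>q. q powr r) has_real_derivative r * q powr (r - 1)) (at q)"
    using assms by (rule_tac has_real_derivative_powr) auto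
  ultimately show ?thesis
    using assms Gamma_real_pos[OF assms(1)] by (simp add: 0 birth_op_def powr_diff field_simps)
next
  case (Suc j)
  define c where "c = Gamma (r + real (Suc j)) / (fact (Suc j) * Gamma r)"
  have "Gamma (r + real j + 1) = (r + real j) * Gamma (r + real j)"
    using assms by (intro Gamma_plus1) (auto dest: nonpos_Ints_nonpos)
  then have c: "(r + real j) * (Gamma (r + real j) / (fact j * Gamma r)) = (real j + 1) * c"
  proof -
    have "c = (r + real j) * Gamma (r + real j) / ((real j + 1) * (fact j * Gamma r))"
      using \<open>Gamma (r + real j + 1) = _\<close> by (simp add: c_def add_ac mult.assoc)
    moreover have "real j + 1 \<noteq> 0" by linarith
    ultimately show ?thesis by simp
  qed
  have "(nb_mass r (Suc j) has_real_derivative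
      c * (- (real j + 1) * (1 - q) ^ j * q powr r + (1 - q) ^ Suc j * (r * q powr (r - 1)))) (at q)"
    unfolding nb_mass_def[abs_def] c_def[symmetric]
    using assms by (auto intro!: derivative_eq_intros simp: algebra_simps simp del: power_Suc)
  moreover have op: "birth_op r (\<lambda>j. nb_mass r j q) (Suc j)
      = c * ((real j + 1) * (1 - q) ^ j * q powr r - (r + real j + 1) * (1 - q) ^ Suc j * q powr r)"
  proof -
    have "birth_op r (\<lambda>j. nb_mass r j q) (Suc j)
        = ((r + real j) * (Gamma (r + real j) / (fact j * Gamma r))) * (1 - q) ^ j * q powr r
          - (r + real j + 1) * (c * (1 - q) ^ Suc j * q powr r)"
      unfolding birth_op_def nb_mass_def c_def by (simp add: algebra_simps)
    then show ?thesis unfolding c by (simp only: algebra_simps)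
  qed
  ultimately show ?thesis
    unfolding Suc
    by (elim back_subst[where P = "\<lambda>d. (_ has_real_derivative d) (at q)"])
      (use assms in \<open>simp add: op powr_diff field_simps\<close>)
qed

lemma measure_K_dist_singleton:
  assumes "m \<ge> 1" "\<delta> > - real m"
  shows "measure (K_dist m \<delta>) {k}
    = (LINT u:{0<..<1}|lborel. nb_mass (real m + \<delta>) k (u powr (1 / (2 + \<delta> / real m))))"
  unfolding measure_K_dist[OF assms] 
  using K_dist_parameter[OF assms] assms
  by (intro set_lebesgue_integral_cong) (auto simp: measure_pmf_single pmf_nb nb_mass_def)

lemma nb_mass_uniform_has_integral:
  assumes "m \<ge> 1" "\<delta> > - real m"
  shows "((\<lambda>u. nb_mass (real m + \<delta>) k (u powr (1 / (2 + \<delta> / real m))))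
           has_integral measure (K_dist m \<delta>) {k}) {0<..<1}"
proof -
  let ?f = "\<lambda>u. nb_mass (real m + \<delta>) k (u powr (1 / (2 + \<delta> / real m)))"
  let ?S = "{0<..<1::real}"
  have "set_integrable lborel ?S ?f"
  proof (rule set_integrable_bound)
    show "set_integrable lborel ?S (\<lambda>_. 1 :: real)"
      unfolding set_integrable_def by simp
    show "set_borel_measurable lborel ?S ?f"
      unfolding set_borel_measurable_def nb_mass_def by measurable
    show "AE u in lborel. u \<in> ?S \<longrightarrow> norm (?f u) \<le> norm (1 :: real)"
    proof (rule AE_I2, rule impI)
      fix u assume "u \<in> ?S"
      then show "norm (?f u) \<le> norm (1 :: real)"
        using pmf_nb[of "real m + \<delta>" "u powr (1 / (2 + \<delta> / real m))" k]
          K_dist_parameter[OF assms, of u] assms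
          pmf_le_1[of "nb_pmf (real m + \<delta>) (u powr (1 / (2 + \<delta> / real m)))" k]
          pmf_nonneg[of "nb_pmf (real m + \<delta>) (u powr (1 / (2 + \<delta> / real m)))" k]
        by (simp add: nb_mass_def)
    qed
  qed
  from set_borel_integral_eq_integral[OF this] show ?thesis
    unfolding measure_K_dist_singleton[OF assms] by (metis integrable_integral)
qed

text \<open>
  By the chain rule and the derivative of the negative binomial masses, the function
  \<open>u \<mapsto> u \<cdot> nb_mass r k (u\<^bsup>1/\<beta>\<^esup>)\<close> has derivative \<open>nb_mass - L nb_mass / \<beta>\<close>. Its integral over \<open>(0, 1)\<close> is
  \<open>p k - L p k / \<beta>\<close>, and its boundary values are \<open>0\<close> at \<open>u = 0\<close> and \<open>nb_mass r k 1 = [k = 0]\<close> at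
  \<open>u = 1\<close>.
\<close>

lemma K_dist_stationary:
  assumes "m \<ge> 1" "\<delta> > - real m"
  defines "p \<equiv> \<lambda>k. measure (K_dist m \<delta>) {k}"
  shows "birth_op (real m + \<delta>) p k = (2 + \<delta> / real m) * (p k - of_bool (k = 0))"
proof -
  define r \<beta> where "r = real m + \<delta>" and "\<beta> = 2 + \<delta> / real m"
  have r: "r > 0" using assms by (simp add: r_def)
  have \<beta>: "\<beta> > 1" using assms by (simp add: \<beta>_def field_simps)
  define q where "q u = u powr (1 / \<beta>)" for u :: real
  have p: "((\<lambda>u. nb_mass r j (q u)) has_integral p j) {0<..<1}" for j
    unfolding r_def q_def \<beta>_def p_def by (rule nb_mass_uniform_has_integral[OF assms(1,2)])
  define g where "g u = nb_mass r k (q u) - birth_op r (\<lambda>j. nb_mass r j (q u)) k / \<beta>" for u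
  have "(g has_integral p k - birth_op r p k / \<beta>) {0<..<1}"
    unfolding g_def birth_op_def
    by (cases k) (simp_all del: diff_0 add: has_integral_diff has_integral_divide
        has_integral_mult_right p has_integral_0)
  moreover have "(g has_integral 1 * nb_mass r k (q 1) - 0 * nb_mass r k (q 0)) {0..1}"
  proof (rule fundamental_theorem_of_calculus_interior)
    show "continuous_on {0..1} (\<lambda>u. u * nb_mass r k (q u))"
      unfolding nb_mass_def q_def using r \<beta>
      by (intro continuous_intros continuous_on_powr') auto
    fix u :: real assume u: "u \<in> {0<..<1}"
    have q: "q u > 0" using u by (simp add: q_def)
    have q': "(q has_real_derivative (1 / \<beta>) * (q u / u)) (at u)"
    proof -
      have "(q has_real_derivative (1 / \<beta>) * u powr (1 / \<beta> - 1)) (at u)"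
        unfolding q_def[abs_def] using u by (rule_tac has_real_derivative_powr) auto
      then show ?thesis using u by (simp add: q_def powr_diff)
    qed
    have "((\<lambda>u. nb_mass r k (q u)) has_real_derivative
        (- birth_op r (\<lambda>j. nb_mass r j (q u)) k / q u) * ((1 / \<beta>) * (q u / u))) (at u)"
      by (rule DERIV_chain2[OF nb_mass_has_derivative[OF r q] q'])
    from DERIV_mult[OF DERIV_ident this]
    have "((\<lambda>u. u * nb_mass r k (q u)) has_real_derivative g u) (at u)"
      by (rule back_subst[where P = "\<lambda>d. (_ has_real_derivative d) (at u)"])
        (use u q \<beta> in \<open>simp add: g_def field_simps\<close>)
    then show "((\<lambda>u. u * nb_mass r k (q u)) has_vector_derivative g u) (at u)"
      by (simp add: has_real_derivative_iff_has_vector_derivative)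
  qed simp
  ultimately have "p k - birth_op r p k / \<beta> = 1 * nb_mass r k (q 1) - 0 * nb_mass r k (q 0)"
    using has_integral_Icc_iff_Ioo has_integral_unique by blast
  also have "\<dots> = of_bool (k = 0)"
    using Gamma_real_pos[OF r] by (simp add: nb_mass_def q_def)
  finally show ?thesis
    using \<beta> unfolding r_def[symmetric] \<beta>_def[symmetric] by (simp add: field_simps)
qed

section \<open>Group sizes\<close>

definition group_size :: "nat \<Rightarrow> nat \<Rightarrow> nat \<Rightarrow> nat" where
  "group_size m t g = card {v \<in> {1..t}. group_index m v = g}"

lemma group_index_ge_1: "m \<ge> 1 \<Longrightarrow> v \<ge> 1 \<Longrightarrow> group_index m v \<ge> 1"
  by (simp add: group_index_def div_greater_zero_iff Suc_leI)

lemma group_index_mono: "v \<le> w \<Longrightarrow> group_index m v \<le> group_index m w"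
  by (simp add: group_index_def div_le_mono)

lemma group_size_le:
  assumes "m \<ge> 1" "g \<ge> 1"
  shows "group_size m t g \<le> m"
proof -
  have "group_size m t g \<le> card {m * (g - 1) + 1..m * g}"
    unfolding group_size_def using group_index_eq_iff[OF assms] by (intro card_mono) auto
  also have "\<dots> = m" using assms by (cases g) auto
  finally show ?thesis .
qed

lemma group_size_complete:
  assumes "m \<ge> 1" "g \<ge> 1" "m * g \<le> t"
  shows "group_size m t g = m"
proof -
  have "v \<in> {1..t} \<and> group_index m v = g \<longleftrightarrow> v \<in> {m * (g - 1) + 1..m * g}" for v
  proof -
    have "v \<in> {1..t}" if "v \<in> {m * (g - 1) + 1..m * g}"
      unfolding atLeastAtMost_iff using that order_trans[OF _ assms(3), of v] by simp
    then show ?thesis unfolding group_index_eq_iff[OF assms(1,2)] by blast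
  qed
  then have "{v \<in> {1..t}. group_index m v = g} = {m * (g - 1) + 1..m * g}"
    by (simp only: Collect_mem_eq)
  then have "group_size m t g = m * g - m * (g - 1)" by (simp add: group_size_def)
  also have "\<dots> = m" using assms(2) by (cases g) simp_all
  finally show ?thesis .
qed

text \<open>
  Only the group of the newest vertex can be incomplete, and it contributes at most \<open>m\<close> vertices
  with at most \<open>m\<close> missing members each.
\<close>

lemma sum_missing_members_le:
  assumes "m \<ge> 1"
  shows "(\<Sum>v\<in>{1..t}. real m - real (group_size m (Suc t) (group_index m v))) \<le> real m * real m"
proof -
  define g where "g = group_index m (Suc t)"
  have g1: "g \<ge> 1" unfolding g_def using assms by (intro group_index_ge_1) auto
  let ?S = "{v \<in> {1..t}. group_index m v = g}"
  have "(\<Sum>v\<in>{1..t}. real m - real (group_size m (Suc t) (group_index m v)))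
      = (\<Sum>v\<in>?S. real m - real (group_size m (Suc t) (group_index m v)))"
  proof (intro sum.mono_neutral_right ballI)
    fix v assume v: "v \<in> {1..t} - ?S"
    define h where "h = group_index m v"
    have h: "h \<ge> 1" "h < g"
      using v group_index_mono[of v "Suc t" m] group_index_ge_1[OF assms, of v]
      by (auto simp: g_def h_def)
    have "m * h \<le> m * (g - 1)" using h by (intro mult_left_mono) auto
    also have "\<dots> \<le> Suc t" using group_index_eq_iff[OF assms g1, of "Suc t"] by (simp add: g_def)
    finally show "real m - real (group_size m (Suc t) (group_index m v)) = 0"
      using group_size_complete[OF assms h(1)] by (simp add: h_def)
  qed auto
  also have "\<dots> \<le> (\<Sum>v\<in>?S. real m)" by (intro sum_mono) simp
  also have "\<dots> = real (group_size m t g) * real m" by (simp add: group_size_def)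
  also have "\<dots> \<le> real m * real m"
    using group_size_le[OF assms g1] by (intro mult_right_mono) auto
  finally show ?thesis .
qed

section \<open>The in-degree of one group\<close>

text \<open>
  The reciprocal of the normalising constant when vertex \<open>t\<close> chooses its target.
\<close>

definition attach_rate :: "real \<Rightarrow> nat \<Rightarrow> real" where
  "attach_rate \<epsilon> t = 1 / (real t * (2 + \<epsilon>) - 1)"

lemma attach_rate_bounds:
  assumes "\<epsilon> > -1" "t \<ge> 1"
  shows "attach_rate \<epsilon> t > 0" "(1 + \<epsilon>) * attach_rate \<epsilon> t \<le> 1 / real t"
proof -
  define d where "d = real t * (2 + \<epsilon>) - 1"
  have d: "(1 + \<epsilon>) * real t \<le> d" using assms by (simp add: d_def algebra_simps)
  moreover have "(1 + \<epsilon>) * real t > 0" using assms by simp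
  ultimately have "d > 0" by linarith
  then show "attach_rate \<epsilon> t > 0" by (simp add: attach_rate_def d_def)
  show "(1 + \<epsilon>) * attach_rate \<epsilon> t \<le> 1 / real t"
    unfolding attach_rate_def d_def[symmetric] using d \<open>d > 0\<close> assms by (simp add: field_simps)
qed

lemma tree_shaped_headD: "tree_shaped t G \<Longrightarrow> e \<in> arcs G \<Longrightarrow> head G e \<in> {1..t}"
  by (simp add: tree_shaped_def)

lemma in_degree_collapse:
  "in_degree (collapse m G) g = card {e \<in> arcs G. group_index m (head G e) = g}"
  by (simp add: in_degree_def in_arcs_def collapse_def)

lemma in_degree_collapse_extend:
  assumes "tree_shaped t G"
  shows "in_degree (collapse m (pa_extend G (Suc t) j)) g
    = in_degree (collapse m G) g + of_bool (group_index m j = g)"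
proof -
  have "{e \<in> arcs (pa_extend G (Suc t) j). group_index m (head (pa_extend G (Suc t) j) e) = g}
    = {e \<in> arcs G. group_index m (head G e) = g} \<union> (if group_index m j = g then {Suc t} else {})"
    using assms by (auto simp: pa_extend_def tree_shaped_def)
  moreover have "Suc t \<notin> arcs G" "finite (arcs G)" using assms by (auto simp: tree_shaped_def)
  ultimately show ?thesis by (simp add: in_degree_collapse)
qed

lemma in_degree_collapse_eq_sum:
  assumes "tree_shaped t G"
  shows "in_degree (collapse m G) g = (\<Sum>j \<in> {j \<in> {1..Suc t}. group_index m j = g}. in_degree G j)"
proof -
  have "(\<Sum>j \<in> {j \<in> {1..Suc t}. group_index m j = g}. in_degree G j)
      = card (\<Union>j \<in> {j \<in> {1..Suc t}. group_index m j = g}. {e \<in> arcs G. head G e = j})"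
    using assms unfolding in_degree_def in_arcs_def
    by (subst card_UN_disjoint) (auto simp: tree_shaped_def)
  also have "(\<Union>j \<in> {j \<in> {1..Suc t}. group_index m j = g}. {e \<in> arcs G. head G e = j})
      = {e \<in> arcs G. group_index m (head G e) = g}"
    using tree_shaped_headD[OF assms] by force
  finally show ?thesis by (simp add: in_degree_collapse)
qed

text \<open>
  Each vertex \<open>j \<le> t + 1\<close>, the new one included, has weight in-degree plus \<open>1 + \<epsilon>\<close>: an older vertex has
  out-degree one, and the new vertex has in-degree zero and counts with degree one. Adding up over the
  group gives its in-degree and \<open>1 + \<epsilon>\<close> per member.
\<close>

lemma prob_target_group:
  assumes "\<epsilon> > -1" "tree_shaped t G"
  shows "measure_pmf.prob (pa_target \<epsilon> G (Suc t)) {j. group_index m j = g}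
    = attach_rate \<epsilon> (Suc t) * ((1 + \<epsilon>) * real (group_size m (Suc t) g) + real (in_degree (collapse m G) g))"
proof -
  let ?S = "{j \<in> {1..Suc t}. group_index m j = g}"
  note target = pmf_pa_target_aux[OF assms]
  have "{e \<in> arcs G. head G e = Suc t} = {}"
    using tree_shaped_headD[OF assms(2)] by force
  then have "in_degree G (Suc t) = 0"
    by (simp only: in_degree_def in_arcs_def card.empty)
  then have w: "pa_weight \<epsilon> G (Suc t) j = real (in_degree G j) + (1 + \<epsilon>)" if "j \<in> ?S" for j
    using that out_degree_tree_shaped[OF assms(2), of j] by (auto simp: pa_weight_def le_Suc_eq)
  have "measure_pmf.prob (pa_target \<epsilon> G (Suc t)) {j. group_index m j = g}
      = measure_pmf.prob (pa_target \<epsilon> G (Suc t)) ?S"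
    by (intro measure_prob_cong_0) (auto simp: target)
  also have "\<dots> = (\<Sum>j\<in>?S. pmf (pa_target \<epsilon> G (Suc t)) j)"
    by (intro measure_measure_pmf_finite) auto
  also have "\<dots> = (\<Sum>j\<in>?S. attach_rate \<epsilon> (Suc t) * (real (in_degree G j) + (1 + \<epsilon>)))"
    by (intro sum.cong refl) (auto simp: target w attach_rate_def)
  also have "\<dots> = attach_rate \<epsilon> (Suc t) * (real (\<Sum>j\<in>?S. in_degree G j) + (1 + \<epsilon>) * real (card ?S))"
    unfolding sum_distrib_left[symmetric] by (simp add: sum.distrib)
  finally show ?thesis
    unfolding in_degree_collapse_eq_sum[OF assms(2)] group_size_def by (simp add: algebra_simps)
qed

definition group_law :: "nat \<Rightarrow> real \<Rightarrow> nat \<Rightarrow> nat \<Rightarrow> nat pmf" where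
  "group_law m \<epsilon> t g = map_pmf (\<lambda>G. in_degree (collapse m G) g) (pa_tree \<epsilon> t)"

lemma pmf_group_law_le_1: "(\<Sum>k\<le>n. pmf (group_law m \<epsilon> t g) k) \<le> 1"
  using measure_measure_pmf_finite[of "{..n}" "group_law m \<epsilon> t g"]
  by (metis finite_atMost measure_pmf.prob_le_1)

text \<open>
  Given the graph on \<open>t\<close> vertices, the degree of the group grows by one with a probability that
  depends on the graph only through this degree, so the law alone satisfies the forward equation.
\<close>

lemma group_law_Suc:
  assumes "\<epsilon> > -1" "t \<ge> 1"
  shows "pmf (group_law m \<epsilon> (Suc t) g) k = pmf (group_law m \<epsilon> t g) k
    + attach_rate \<epsilon> (Suc t) * birth_op ((1 + \<epsilon>) * real (group_size m (Suc t) g)) (pmf (group_law m \<epsilon> t g)) k"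
proof -
  define D where "D G = in_degree (collapse m G) g" for G
  define s where "s = (1 + \<epsilon>) * real (group_size m (Suc t) g)"
  define \<pi> where "\<pi> d = attach_rate \<epsilon> (Suc t) * (s + real d)" for d :: nat
  let ?T = "pa_tree \<epsilon> t"
  \<comment> \<open>The probability, given \<open>G\<close>, that the degree is \<open>k\<close> after the step.\<close>
  define h where "h G = (1 - \<pi> k) * indicator (D -` {k}) G
    + (case k of 0 \<Rightarrow> 0 | Suc j \<Rightarrow> \<pi> j * indicator (D -` {j}) G)" for G
  obtain u where t: "t = Suc u" using assms(2) by (cases t) auto
  have "group_law m \<epsilon> (Suc t) g
    = bind_pmf ?T (\<lambda>G. map_pmf (\<lambda>j. D (pa_extend G (Suc t) j)) (pa_target \<epsilon> G (Suc t)))"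
    unfolding group_law_def t D_def by (simp add: map_bind_pmf map_pmf_def[symmetric] pmf.map_comp o_def)
  then have "pmf (group_law m \<epsilon> (Suc t) g) k
    = measure_pmf.expectation ?T (\<lambda>G. pmf (map_pmf (\<lambda>j. D (pa_extend G (Suc t) j)) (pa_target \<epsilon> G (Suc t))) k)"
    by (simp add: pmf_bind)
  also have "\<dots> = measure_pmf.expectation ?T h"
  proof (intro integral_cong_AE AE_pmfI)
    fix G assume "G \<in> set_pmf ?T"
    then have ts: "tree_shaped t G" using tree_shaped_pa_tree assms by blast
    let ?P = "measure_pmf.prob (pa_target \<epsilon> G (Suc t))"
    have P: "?P {j. group_index m j = g} = \<pi> (D G)"
      unfolding prob_target_group[OF assms(1) ts] \<pi>_def s_def D_def ..
    have "?P (- {j. group_index m j = g}) = 1 - \<pi> (D G)"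
      using measure_pmf.prob_compl[of "{j. group_index m j = g}" "pa_target \<epsilon> G (Suc t)"] P
      by (simp add: Compl_eq_Diff_UNIV)
    moreover have "(\<lambda>j. D (pa_extend G (Suc t) j)) -` {k}
      = (if k = D G then - {j. group_index m j = g} else if k = Suc (D G) then {j. group_index m j = g} else {})"
      (is "?L = ?R")
    proof (rule set_eqI)
      fix j show "j \<in> ?L \<longleftrightarrow> j \<in> ?R"
        unfolding D_def in_degree_collapse_extend[OF ts] by (cases "group_index m j = g") auto
    qed
    ultimately show "pmf (map_pmf (\<lambda>j. D (pa_extend G (Suc t) j)) (pa_target \<epsilon> G (Suc t))) k = h G"
      using P by (auto simp: pmf_map h_def split: nat.split)
  qed auto
  also have "\<dots> = (1 - \<pi> k) * pmf (group_law m \<epsilon> t g) k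
    + (case k of 0 \<Rightarrow> 0 | Suc j \<Rightarrow> \<pi> j * pmf (group_law m \<epsilon> t g) j)"
  proof -
    have q: "measure_pmf.prob ?T (D -` {j}) = pmf (group_law m \<epsilon> t g) j" for j
      unfolding group_law_def pmf_map D_def ..
    have int: "integrable ?T (\<lambda>G. c * indicator (D -` {j}) G :: real)" for c j
      by (intro integrable_mult_right measure_pmf.integrable_const_bound[where B = 1]) auto
    show ?thesis
      unfolding h_def by (cases k) (simp_all add: q Bochner_Integration.integral_add[OF int int])
  qed
  finally show ?thesis
    unfolding birth_op_def s_def[symmetric] \<pi>_def by (cases k) (simp_all add: algebra_simps)
qed

lemma group_law_before_birth:
  assumes "\<epsilon> > -1" "t \<ge> 1" "\<And>v. v \<in> {1..t} \<Longrightarrow> group_index m v \<noteq> g"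
  shows "group_law m \<epsilon> t g = return_pmf 0"
proof -
  have "in_degree (collapse m G) g = 0" if "G \<in> set_pmf (pa_tree \<epsilon> t)" for G
    using tree_shaped_pa_tree[OF assms(1,2) that] assms(3)
    by (auto simp: in_degree_collapse tree_shaped_def)
  then have "group_law m \<epsilon> t g = map_pmf (\<lambda>_. 0) (pa_tree \<epsilon> t)"
    unfolding group_law_def by (intro map_pmf_cong) auto
  then show ?thesis by simp
qed

lemma group_law_support:
  assumes "\<epsilon> > -1" "t \<ge> 1" "k > t"
  shows "pmf (group_law m \<epsilon> t g) k = 0"
proof -
  have "in_degree (collapse m G) g \<le> t" if "G \<in> set_pmf (pa_tree \<epsilon> t)" for G
  proof -
    have "card {e \<in> arcs G. group_index m (head G e) = g} \<le> card {1..t}"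
      using tree_shaped_pa_tree[OF assms(1,2) that] by (intro card_mono) (auto simp: tree_shaped_def)
    then show ?thesis by (simp add: in_degree_collapse)
  qed
  then have "k \<notin> set_pmf (group_law m \<epsilon> t g)"
    using assms(3) by (auto simp: group_law_def leD)
  then show ?thesis by (simp add: set_pmf_iff)
qed

text \<open>
  The group of vertex \<open>t + 1\<close> started after vertex \<open>s > t - m\<close>. At each of the at most \<open>m\<close> steps since
  then it was hit for the first time with probability at most \<open>m / (s + 1)\<close>, and
  \<open>t + 1 \<le> m (s + 1)\<close>.
\<close>

lemma newborn_group_degree:
  assumes "m \<ge> 1" "\<epsilon> > -1" "t \<ge> m"
  shows "1 - pmf (group_law m \<epsilon> (Suc t) (group_index m (Suc t))) 0 \<le> real m ^ 3 / real (Suc t)"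
proof -
  define g where "g = group_index m (Suc t)"
  define s where "s = m * (g - 1)"
  have g1: "g \<ge> 1" unfolding g_def using assms by (intro group_index_ge_1) auto
  have "Suc t \<in> {s + 1..m * g}"
    using group_index_eq_iff[OF assms(1) g1, of "Suc t"] by (simp add: g_def s_def)
  then have st: "s \<le> t" "Suc t \<le> s + m" using g1 by (cases g; simp add: s_def)+
  \<comment> \<open>As \<open>t \<ge> m\<close>, the group is not the first one; so the graph at time \<open>s\<close> is not the empty dummy.\<close>
  have s: "s \<ge> 1"
  proof (rule ccontr)
    assume "\<not> s \<ge> 1"
    then show False using st assms by simp
  qed
  have decay: "1 - pmf (group_law m \<epsilon> (s + l) g) 0 \<le> real l * (real m / real (s + 1))" for l
  proof (induction l)
    case 0
    have "group_law m \<epsilon> s g = return_pmf 0"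
      using group_index_eq_iff[OF assms(1) g1] s assms
      by (intro group_law_before_birth) (auto simp: s_def)
    then show ?case by simp
  next
    case (Suc l)
    let ?q = "pmf (group_law m \<epsilon> (s + l) g) 0"
    let ?a = "attach_rate \<epsilon> (Suc (s + l))" and ?c = "real (group_size m (Suc (s + l)) g)"
    have "pmf (group_law m \<epsilon> (s + Suc l) g) 0 = ?q - ?c * ((1 + \<epsilon>) * ?a) * ?q"
      using group_law_Suc[OF assms(2), of "s + l" m g 0] s by (simp add: birth_op_def algebra_simps)
    moreover have "?c * ((1 + \<epsilon>) * ?a) * ?q \<le> real m * (1 / real (s + 1)) * 1"
    proof (intro mult_mono)
      have "(1 + \<epsilon>) * ?a \<le> 1 / real (Suc (s + l))" by (rule attach_rate_bounds(2)[OF assms(2)]) simp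
      also have "\<dots> \<le> 1 / real (s + 1)" by (intro divide_left_mono) auto
      finally show "(1 + \<epsilon>) * ?a \<le> 1 / real (s + 1)" .
    qed (use group_size_le[OF assms(1) g1] attach_rate_bounds(1)[OF assms(2), of "Suc (s + l)"] assms
        in \<open>auto simp: pmf_le_1\<close>)
    ultimately show ?case using Suc by (simp add: algebra_simps add_divide_distrib)
  qed
  have "1 - pmf (group_law m \<epsilon> (Suc t) g) 0 \<le> real (Suc t - s) * (real m / real (s + 1))"
    using decay[of "Suc t - s"] st by simp
  also have "\<dots> \<le> real m * (real m * (real m / real (Suc t)))"
  proof (intro mult_mono)
    have "Suc t \<le> m * (s + 1)"
    proof -
      have "s \<le> m * s" using assms by (cases m) auto
      then show ?thesis unfolding distrib_left using st by linarith
    qed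
    then have "real (Suc t) \<le> real m * real (s + 1)" by (metis of_nat_le_iff of_nat_mult)
    then have "1 / real (s + 1) \<le> real m / real (Suc t)" by (simp add: field_simps)
    from mult_left_mono[OF this, of "real m"]
    show "real m / real (s + 1) \<le> real m * (real m / real (Suc t))" by simp
  qed (use st in auto)
  finally show ?thesis by (simp add: g_def power3_eq_cube mult.assoc)
qed

section \<open>Expected degree counts\<close>

text \<open>
  The expected number of groups of in-degree \<open>k\<close>, where an incomplete group counts with the fraction of
  its members that are present. This weighting makes the total mass grow by the same amount at each
  step.
\<close>

definition mean_count :: "nat \<Rightarrow> real \<Rightarrow> nat \<Rightarrow> nat \<Rightarrow> real" where
  "mean_count m \<epsilon> t k = (\<Sum>v\<in>{1..t}. pmf (group_law m \<epsilon> t (group_index m v)) k) / real m"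

lemma sum_mean_count_le:
  assumes "m \<ge> 1"
  shows "(\<Sum>k\<le>n. mean_count m \<epsilon> t k) \<le> real t / real m"
proof -
  have "(\<Sum>k\<le>n. mean_count m \<epsilon> t k)
      = (\<Sum>v\<in>{1..t}. \<Sum>k\<le>n. pmf (group_law m \<epsilon> t (group_index m v)) k) / real m"
    unfolding mean_count_def sum_divide_distrib[symmetric] by (subst sum.swap) (rule refl)
  also have "\<dots> \<le> (\<Sum>v\<in>{1..t}. 1) / real m"
    by (intro divide_right_mono sum_mono pmf_group_law_le_1) simp
  finally show ?thesis by simp
qed

text \<open>
  At time \<open>n m\<close> all \<open>n\<close> groups are complete, so each of them occurs \<open>m\<close> times in the sum over vertices.
\<close>

lemma indegree_law_eq_mean_count:
  assumes "m \<ge> 1" "n \<ge> 1"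
  shows "pmf (indegree_law m \<delta> n) k = mean_count m (\<delta> / real m) (n * m) k / real n"
proof -
  let ?\<epsilon> = "\<delta> / real m"
  let ?q = "\<lambda>g. pmf (group_law m ?\<epsilon> (n * m) g) k"
  have "indegree_law m \<delta> n
      = bind_pmf (pmf_of_set {1..n}) (\<lambda>g. group_law m ?\<epsilon> (n * m) g)"
    unfolding indegree_law_def pair_pmf_def pa_graph_def group_law_def
    by (subst bind_commute_pmf) (simp add: map_bind_pmf map_pmf_def bind_assoc_pmf bind_return_pmf)
  then have "pmf (indegree_law m \<delta> n) k = (\<Sum>g\<in>{1..n}. ?q g) / real n"
    using assms by (simp add: pmf_bind_pmf_of_set)
  moreover have "(\<Sum>v\<in>{1..n * m}. ?q (group_index m v)) = (\<Sum>g\<in>{1..n}. real m * ?q g)"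
  proof -
    have range: "group_index m v \<in> {1..n}" if v: "v \<in> {1..n * m}" for v
    proof -
      have "group_index m (n * m) = n"
        using group_index_eq_iff[OF assms, of "n * m"] assms by (cases n) (auto simp: mult.commute)
      then show ?thesis
        using group_index_ge_1[OF assms(1), of v] group_index_mono[of v "n * m" m] v by auto
    qed
    have "(\<Sum>v\<in>{1..n * m}. ?q (group_index m v))
        = (\<Sum>g\<in>{1..n}. \<Sum>v\<in>{v \<in> {1..n * m}. group_index m v = g}. ?q (group_index m v))"
      using range by (intro sum.group[symmetric]) auto
    also have "\<dots> = (\<Sum>g\<in>{1..n}. real (group_size m (n * m) g) * ?q g)"
      by (intro sum.cong refl) (simp add: group_size_def)
    also have "\<dots> = (\<Sum>g\<in>{1..n}. real m * ?q g)"
    proof (intro sum.cong refl)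
      fix g assume g: "g \<in> {1..n}"
      then have "m * g \<le> n * m" by simp
      then show "real (group_size m (n * m) g) * ?q g = real m * ?q g"
        using group_size_complete[OF assms(1), of g "n * m"] g by simp
    qed
    finally show ?thesis .
  qed
  ultimately show ?thesis
    using assms by (simp add: mean_count_def sum_distrib_left[symmetric])
qed

lemma pmf_distance_from_0:
  "(\<Sum>k\<le>n. \<bar>pmf q k - of_bool (k = 0)\<bar>) \<le> 2 * (1 - pmf q (0::nat))"
proof -
  have "(\<Sum>k\<le>n. \<bar>pmf q k - of_bool (k = 0)\<bar>) = \<bar>pmf q 0 - 1\<bar> + (\<Sum>k<n. pmf q (Suc k))"
    by (simp add: sum.atMost_shift)
  also have "(\<Sum>k<n. pmf q (Suc k)) = (\<Sum>k\<le>n. pmf q k) - pmf q 0"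
    by (simp add: sum.atMost_shift)
  also have "(\<Sum>k\<le>n. pmf q k) \<le> 1"
    using measure_measure_pmf_finite[of "{..n}" q]
    by (metis finite_atMost measure_pmf.prob_le_1)
  finally show ?thesis using pmf_le_1[of q 0] by simp
qed

text \<open>
  There are two sources of error. The group of a vertex may be incomplete, so that its law evolves with
  a smaller shape parameter than \<open>m (1 + \<epsilon>)\<close>; and the group that the new vertex joins need not have
  in-degree zero.
\<close>

lemma mean_count_Suc:
  assumes "m \<ge> 1" "\<epsilon> > -1" "t \<ge> m"
  shows "(\<Sum>k\<le>n. \<bar>mean_count m \<epsilon> (Suc t) k - mean_count m \<epsilon> t k
      - attach_rate \<epsilon> (Suc t) * birth_op (real m * (1 + \<epsilon>)) (mean_count m \<epsilon> t) k - of_bool (k = 0) / real m\<bar>)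
    \<le> (2 * real m + 2 * real m ^ 2) / real (Suc t)"
proof -
  define a where "a = attach_rate \<epsilon> (Suc t)"
  define r where "r = real m * (1 + \<epsilon>)"
  define q where "q v = group_law m \<epsilon> t (group_index m v)" for v
  define c where "c v = (1 + \<epsilon>) * real (group_size m (Suc t) (group_index m v))" for v
  define new where "new = group_law m \<epsilon> (Suc t) (group_index m (Suc t))"
  define D where "D v k = birth_op (c v) (pmf (q v)) k - birth_op r (pmf (q v)) k" for v k
  have a: "a > 0" "(1 + \<epsilon>) * a \<le> 1 / real (Suc t)"
    using attach_rate_bounds[OF assms(2), of "Suc t"] by (auto simp: a_def)
  have t1: "t \<ge> 1" using assms by simp
  have F: "mean_count m \<epsilon> t = (\<lambda>k. (\<Sum>v\<in>{1..t}. pmf (q v) k) / real m)"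
    by (simp add: mean_count_def q_def fun_eq_iff)
  have F': "mean_count m \<epsilon> (Suc t) k
      = ((\<Sum>v\<in>{1..t}. pmf (q v) k + a * birth_op (c v) (pmf (q v)) k) + pmf new k) / real m" for k
    unfolding mean_count_def q_def c_def a_def new_def
    by (simp add: group_law_Suc[OF assms(2) t1, symmetric])
  have eq: "mean_count m \<epsilon> (Suc t) k - mean_count m \<epsilon> t k
      - a * birth_op r (mean_count m \<epsilon> t) k - of_bool (k = 0) / real m
    = (a * (\<Sum>v\<in>{1..t}. D v k) + (pmf new k - of_bool (k = 0))) / real m" for k
  proof -
    define x y z where "x = (\<Sum>v\<in>{1..t}. pmf (q v) k)"
      and "y = (\<Sum>v\<in>{1..t}. birth_op (c v) (pmf (q v)) k)"
      and "z = (\<Sum>v\<in>{1..t}. birth_op r (pmf (q v)) k)"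
    have "(\<Sum>v\<in>{1..t}. pmf (q v) k + a * birth_op (c v) (pmf (q v)) k) = x + a * y"
      by (simp add: x_def y_def sum.distrib sum_distrib_left)
    moreover have "(\<Sum>v\<in>{1..t}. D v k) = y - z"
      by (simp add: D_def y_def z_def sum_subtractf)
    moreover have "birth_op r (mean_count m \<epsilon> t) k = z / real m"
      unfolding F birth_op_sum z_def ..
    moreover have "mean_count m \<epsilon> t k = x / real m" by (simp add: F x_def)
    ultimately show ?thesis unfolding F'
      by (simp only: add_divide_distrib diff_divide_distrib right_diff_distrib times_divide_eq_right)
  qed
  have "(\<Sum>k\<le>n. \<bar>(a * (\<Sum>v\<in>{1..t}. D v k) + (pmf new k - of_bool (k = 0))) / real m\<bar>)
      \<le> (\<Sum>k\<le>n. (a * (\<Sum>v\<in>{1..t}. \<bar>D v k\<bar>) + \<bar>pmf new k - of_bool (k = 0)\<bar>) / real m)"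
  proof (intro sum_mono)
    fix k
    have "\<bar>a * (\<Sum>v\<in>{1..t}. D v k)\<bar> \<le> a * (\<Sum>v\<in>{1..t}. \<bar>D v k\<bar>)"
      using a by (simp add: abs_mult sum_abs)
    then have "\<bar>a * (\<Sum>v\<in>{1..t}. D v k) + (pmf new k - of_bool (k = 0))\<bar>
        \<le> a * (\<Sum>v\<in>{1..t}. \<bar>D v k\<bar>) + \<bar>pmf new k - of_bool (k = 0)\<bar>" by linarith
    then show "\<bar>(a * (\<Sum>v\<in>{1..t}. D v k) + (pmf new k - of_bool (k = 0))) / real m\<bar>
        \<le> (a * (\<Sum>v\<in>{1..t}. \<bar>D v k\<bar>) + \<bar>pmf new k - of_bool (k = 0)\<bar>) / real m"
      by (simp add: divide_right_mono)
  qed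
  also have "\<dots> = (a * (\<Sum>k\<le>n. \<Sum>v\<in>{1..t}. \<bar>D v k\<bar>) + (\<Sum>k\<le>n. \<bar>pmf new k - of_bool (k = 0)\<bar>)) / real m"
    unfolding sum_divide_distrib[symmetric] sum.distrib sum_distrib_left[symmetric] ..
  also have "(\<Sum>k\<le>n. \<Sum>v\<in>{1..t}. \<bar>D v k\<bar>) = (\<Sum>v\<in>{1..t}. \<Sum>k\<le>n. \<bar>D v k\<bar>)"
    by (rule sum.swap)
  also have "(a * (\<Sum>v\<in>{1..t}. \<Sum>k\<le>n. \<bar>D v k\<bar>) + (\<Sum>k\<le>n. \<bar>pmf new k - of_bool (k = 0)\<bar>)) / real m
      \<le> (2 * real m ^ 2 / real (Suc t) + 2 * (real m ^ 3 / real (Suc t))) / real m"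
  proof (intro divide_right_mono add_mono)
    have "(\<Sum>v\<in>{1..t}. \<Sum>k\<le>n. \<bar>D v k\<bar>)
        \<le> (\<Sum>v\<in>{1..t}. 2 * (1 + \<epsilon>) * (real m - real (group_size m (Suc t) (group_index m v))))"
    proof (intro sum_mono)
      fix v assume v: "v \<in> {1..t}"
      have "(\<Sum>k\<le>n. \<bar>D v k\<bar>) \<le> 2 * \<bar>c v - r\<bar>"
        unfolding D_def by (intro birth_op_shape_l1) (auto simp: q_def pmf_group_law_le_1)
      also have "c v \<le> r"
        using group_size_le[OF assms(1) group_index_ge_1[OF assms(1)], of v "Suc t"] v assms(2)
        by (simp add: c_def r_def)
      then have "\<bar>c v - r\<bar> = r - c v" by simp
      finally show "(\<Sum>k\<le>n. \<bar>D v k\<bar>)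
          \<le> 2 * (1 + \<epsilon>) * (real m - real (group_size m (Suc t) (group_index m v)))"
        by (simp add: c_def r_def algebra_simps)
    qed
    also have "\<dots> = 2 * (1 + \<epsilon>)
        * (\<Sum>v\<in>{1..t}. real m - real (group_size m (Suc t) (group_index m v)))"
      by (simp only: sum_distrib_left)
    also have "\<dots> \<le> 2 * (1 + \<epsilon>) * (real m * real m)"
      using assms by (intro mult_left_mono sum_missing_members_le) auto
    finally have "a * (\<Sum>v\<in>{1..t}. \<Sum>k\<le>n. \<bar>D v k\<bar>) \<le> a * (2 * (1 + \<epsilon>) * (real m * real m))"
      using a by (intro mult_left_mono) auto
    also have "\<dots> = 2 * real m ^ 2 * ((1 + \<epsilon>) * a)" by (simp add: power2_eq_square)
    also have "\<dots> \<le> 2 * real m ^ 2 * (1 / real (Suc t))" using a by (intro mult_left_mono) auto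
    finally show "a * (\<Sum>v\<in>{1..t}. \<Sum>k\<le>n. \<bar>D v k\<bar>) \<le> 2 * real m ^ 2 / real (Suc t)" by simp
    have "(\<Sum>k\<le>n. \<bar>pmf new k - of_bool (k = 0)\<bar>) \<le> 2 * (1 - pmf new 0)"
      by (rule pmf_distance_from_0)
    also have "\<dots> \<le> 2 * (real m ^ 3 / real (Suc t))"
      using newborn_group_degree[OF assms] by (simp add: new_def)
    finally show "(\<Sum>k\<le>n. \<bar>pmf new k - of_bool (k = 0)\<bar>) \<le> 2 * (real m ^ 3 / real (Suc t))" .
  qed simp
  also have "\<dots> = (2 * real m + 2 * real m ^ 2) / real (Suc t)"
  proof -
    have "(2 * x ^ 2 / d + 2 * (x ^ 3 / d)) / x = (2 * x + 2 * x ^ 2) / d"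
      if "x > 0" "d > 0" for x d :: real
      using that by (simp add: field_simps power2_eq_square power3_eq_cube)
    then show ?thesis using assms(1) by simp
  qed
  finally show ?thesis by (simp only: eq a_def[symmetric] r_def[symmetric])
qed

section \<open>Growth of the error\<close>

text \<open>
  Substituting \<open>(t / m) p\<close> into the recursion of \<open>mean_count\<close> leaves the defect \<open>\<sigma>\<close>, because
  \<open>1 - t a\<^bsub>t+1\<^esub> (2 + \<epsilon>) = (1 + \<epsilon>) a\<^bsub>t+1\<^esub>\<close>; the defect of \<open>mean_count\<close> itself is \<open>\<rho>\<close>. The term with
  \<open>p (t + 1)\<close> pays for the degree that enters the sum at this step: a graph on \<open>t\<close> vertices has no group
  of in-degree \<open>t + 1\<close>.
\<close>

lemma error_growth:
  fixes m :: nat and \<epsilon> :: real and p :: "nat \<Rightarrow> real"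
  assumes "m \<ge> 1" "\<epsilon> > -1" "t \<ge> m" "\<And>k. p k \<ge> 0"
    and stat: "\<And>k. birth_op (real m * (1 + \<epsilon>)) p k = (2 + \<epsilon>) * (p k - of_bool (k = 0))"
  defines "e \<equiv> \<lambda>t k. mean_count m \<epsilon> t k - real t / real m * p k"
  shows "(\<Sum>k\<le>Suc t. \<bar>e (Suc t) k\<bar>) \<le> (\<Sum>k\<le>t. \<bar>e t k\<bar>)
    + (1 + real m + 1 / (1 + \<epsilon>)) * (real (Suc t) * p (Suc t))
    + (2 * real m + 2 * real m ^ 2 + 2) / real (Suc t)"
proof -
  define r where "r = real m * (1 + \<epsilon>)"
  define a where "a = attach_rate \<epsilon> (Suc t)"
  define \<rho> where "\<rho> k = mean_count m \<epsilon> (Suc t) k - mean_count m \<epsilon> t k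
    - a * birth_op r (mean_count m \<epsilon> t) k - of_bool (k = 0) / real m" for k
  define \<sigma> where "\<sigma> k = (1 + \<epsilon>) * a / real m * (of_bool (k = 0) - p k)" for k
  have a: "a > 0" "(1 + \<epsilon>) * a \<le> 1 / real (Suc t)"
    using attach_rate_bounds[OF assms(2), of "Suc t"] by (auto simp: a_def)
  have m: "real m > 0" using assms by simp
  have r: "r > 0" using assms by (simp add: r_def)
  have den: "real (Suc t) * (2 + \<epsilon>) - 1 > 0"
    using a(1) by (simp add: a_def attach_rate_def)
  have a_eq: "a * (real (Suc t) * (2 + \<epsilon>) - 1) = 1"
    using den by (simp add: a_def attach_rate_def)
  have step: "e (Suc t) k = (e t k + a * birth_op r (e t) k) + (\<rho> k + \<sigma> k)" for k
  proof -
    have L: "birth_op r (e t) k = birth_op r (mean_count m \<epsilon> t) k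
        - real t / real m * ((2 + \<epsilon>) * (p k - of_bool (k = 0)))"
      using birth_op_linear[of r 1 "mean_count m \<epsilon> t" "real t / real m" p k]
      by (simp add: e_def stat[folded r_def])
    have "a * (real t * (2 + \<epsilon>)) = 1 - a * (1 + \<epsilon>)"
      using a_eq by (simp add: algebra_simps)
    then have X: "a * (real t / real m * ((2 + \<epsilon>) * (p k - of_bool (k = 0))))
        = (1 - a * (1 + \<epsilon>)) * (p k - of_bool (k = 0)) / real m"
      by (metis mult.assoc mult.commute times_divide_eq_right)
    have L': "a * birth_op r (e t) k = a * birth_op r (mean_count m \<epsilon> t) k
        - (1 - a * (1 + \<epsilon>)) * (p k - of_bool (k = 0)) / real m"
      unfolding L right_diff_distrib[of a] X ..
    show ?thesis
      unfolding L' unfolding \<rho>_def \<sigma>_def e_def divide_inverse by (simp add: algebra_simps)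
  qed
  have p1: "(\<Sum>k\<le>n. p k) \<le> 1" for n
    using stationary_tail_and_mean(1)[of "2 + \<epsilon>" r p n] assms r by (simp add: r_def)
  have "(\<Sum>k\<le>Suc t. \<bar>e (Suc t) k\<bar>)
      \<le> (\<Sum>k\<le>Suc t. \<bar>e t k + a * birth_op r (e t) k\<bar> + (\<bar>\<rho> k\<bar> + \<bar>\<sigma> k\<bar>))"
    unfolding step by (intro sum_mono) linarith
  also have "\<dots> = (\<Sum>k\<le>Suc t. \<bar>e t k + a * birth_op r (e t) k\<bar>)
      + ((\<Sum>k\<le>Suc t. \<bar>\<rho> k\<bar>) + (\<Sum>k\<le>Suc t. \<bar>\<sigma> k\<bar>))"
    by (simp only: sum.distrib)
  also have "(\<Sum>k\<le>Suc t. \<bar>e t k + a * birth_op r (e t) k\<bar>)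
      \<le> (\<Sum>k\<le>t. \<bar>e t k\<bar>) + \<bar>1 - a * (r + real (Suc t))\<bar> * \<bar>e t (Suc t)\<bar>"
  proof (rule birth_step_l1)
    have "real m * (1 + \<epsilon>) \<le> real t * (1 + \<epsilon>)" using assms by (intro mult_right_mono) auto
    then have "r + real t \<le> real (Suc t) * (2 + \<epsilon>) - 1"
      using assms(2) by (simp add: r_def algebra_simps)
    then have "a * (r + real t) \<le> a * (real (Suc t) * (2 + \<epsilon>) - 1)"
      using a by (intro mult_left_mono) auto
    then show "a * (r + real t) \<le> 1" unfolding a_eq .
  qed (use a r in auto)
  also have "\<bar>1 - a * (r + real (Suc t))\<bar> * \<bar>e t (Suc t)\<bar>
      \<le> (1 + real m + 1 / (1 + \<epsilon>)) * (real (Suc t) * p (Suc t))"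
  proof (intro mult_mono)
    have "mean_count m \<epsilon> t (Suc t) = 0"
      using assms by (simp add: mean_count_def group_law_support)
    then have "\<bar>e t (Suc t)\<bar> = real t / real m * p (Suc t)"
      using assms(4)[of "Suc t"] by (simp add: e_def abs_mult)
    also have "\<dots> \<le> real (Suc t) * p (Suc t)"
    proof (intro mult_right_mono assms(4))
      have "real t / real m \<le> real t / 1" using assms(1) by (intro divide_left_mono) auto
      then show "real t / real m \<le> real (Suc t)" by simp
    qed
    finally show "\<bar>e t (Suc t)\<bar> \<le> real (Suc t) * p (Suc t)" .
    have "a * (r + real (Suc t)) \<le> real m + 1 / (1 + \<epsilon>)"
    proof -
      have "a \<le> 1 / real (Suc t) / (1 + \<epsilon>)"
        using divide_right_mono[OF a(2), of "1 + \<epsilon>"] assms(2) by simp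
      then have "a * (r + real (Suc t)) \<le> 1 / real (Suc t) / (1 + \<epsilon>) * (r + real (Suc t))"
        using r by (intro mult_right_mono) auto
      also have "\<dots> = real m / real (Suc t) + 1 / (1 + \<epsilon>)"
      proof -
        have "1 / T / x * (real m * x + T) = real m / T + 1 / x" if "x > 0" "T > 0" for x T :: real
          using that by (simp add: field_simps)
        then show ?thesis using assms(2) by (simp add: r_def)
      qed
      also have "real m / real (Suc t) \<le> real m / 1" by (intro divide_left_mono) auto
      finally show ?thesis by simp
    qed
    moreover have "a * (r + real (Suc t)) \<ge> 0" using a r by simp
    ultimately show "\<bar>1 - a * (r + real (Suc t))\<bar> \<le> 1 + real m + 1 / (1 + \<epsilon>)" by linarith
  qed (use assms in \<open>auto intro!: add_nonneg_nonneg\<close>)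
  also have "(\<Sum>k\<le>Suc t. \<bar>\<rho> k\<bar>) \<le> (2 * real m + 2 * real m ^ 2) / real (Suc t)"
    unfolding \<rho>_def a_def r_def by (rule mean_count_Suc[OF assms(1-3)])
  also have "(\<Sum>k\<le>Suc t. \<bar>\<sigma> k\<bar>) \<le> 2 / real (Suc t)"
  proof -
    have c: "(1 + \<epsilon>) * a / real m \<le> 1 / real (Suc t)" "(1 + \<epsilon>) * a / real m \<ge> 0"
    proof -
      have "(1 + \<epsilon>) * a \<ge> 0" using a assms(2) by simp
      then have "(1 + \<epsilon>) * a / real m \<le> (1 + \<epsilon>) * a / 1"
        using assms(1) by (intro divide_left_mono) auto
      then show "(1 + \<epsilon>) * a / real m \<le> 1 / real (Suc t)" using a(2) by simp
      show "(1 + \<epsilon>) * a / real m \<ge> 0" using a assms(2) by simp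
    qed
    have "(\<Sum>k\<le>Suc t. \<bar>\<sigma> k\<bar>) \<le> (\<Sum>k\<le>Suc t. 1 / real (Suc t) * (of_bool (k = 0) + p k))"
    proof (intro sum_mono)
      fix k
      have "\<bar>\<sigma> k\<bar> = (1 + \<epsilon>) * a / real m * \<bar>of_bool (k = 0) - p k\<bar>"
        unfolding \<sigma>_def abs_mult[of "(1 + \<epsilon>) * a / real m"] abs_of_nonneg[OF c(2)] ..
      also have "\<dots> \<le> 1 / real (Suc t) * (of_bool (k = 0) + p k)"
        using c assms(4)[of k] by (intro mult_mono) auto
      finally show "\<bar>\<sigma> k\<bar> \<le> 1 / real (Suc t) * (of_bool (k = 0) + p k)" .
    qed
    also have "\<dots> = 1 / real (Suc t) * (1 + (\<Sum>k\<le>Suc t. p k))"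
      unfolding sum_distrib_left[symmetric] sum.distrib by (simp add: sum.atMost_shift)
    also have "\<dots> \<le> 1 / real (Suc t) * (1 + 1)"
      by (intro mult_left_mono add_left_mono p1) simp
    finally show ?thesis by simp
  qed
  finally show ?thesis by (simp add: add_divide_distrib)
qed

text \<open>
  The recursion starts at \<open>t = m\<close>, since \<open>t \<ge> m\<close> ensures \<open>a\<^bsub>t+1\<^esub> (r + k) \<le> 1\<close> for all \<open>k \<le> t\<close>, with
  \<open>r = m (1 + \<epsilon>)\<close>. At \<open>t = m\<close> both parts of the error have mass at most one.
\<close>

lemma error_log_bound:
  fixes m :: nat and \<epsilon> :: real and p :: "nat \<Rightarrow> real"
  assumes "m \<ge> 1" "\<epsilon> > -1" "t \<ge> m" "\<And>k. p k \<ge> 0"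
    and stat: "\<And>k. birth_op (real m * (1 + \<epsilon>)) p k = (2 + \<epsilon>) * (p k - of_bool (k = 0))"
  shows "(\<Sum>k\<le>t. \<bar>mean_count m \<epsilon> t k - real t / real m * p k\<bar>)
    \<le> 2 + (1 + real m + 1 / (1 + \<epsilon>)) * real m + (2 * real m + 2 * real m ^ 2 + 2) * ln (real t)"
proof -
  let ?B = "1 + real m + 1 / (1 + \<epsilon>)" and ?Q = "2 * real m + 2 * real m ^ 2 + 2"
  define E where "E t = (\<Sum>k\<le>t. \<bar>mean_count m \<epsilon> t k - real t / real m * p k\<bar>)" for t
  have r: "real m * (1 + \<epsilon>) > 0" using assms by simp
  have \<beta>: "2 + \<epsilon> > 1" using assms by simp
  note tail = stationary_tail_and_mean[OF \<beta> r assms(4) stat]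
  have "E t \<le> 2 + ?B * (\<Sum>k\<le>t. real k * p k) + ?Q * ln (real t)"
    using assms(3)
  proof (induction t rule: dec_induct)
    case base
    have "E m \<le> (\<Sum>k\<le>m. mean_count m \<epsilon> m k + p k)"
      unfolding E_def
    proof (intro sum_mono)
      fix k
      have "mean_count m \<epsilon> m k \<ge> 0" by (simp add: mean_count_def sum_nonneg)
      then show "\<bar>mean_count m \<epsilon> m k - real m / real m * p k\<bar> \<le> mean_count m \<epsilon> m k + p k"
        using assms(1) assms(4)[of k] by simp
    qed
    also have "\<dots> \<le> 1 + 1"
      using sum_mean_count_le[OF assms(1), of \<epsilon> m m] tail(1)[of m] assms(1)
      by (simp add: sum.distrib)
    also have "\<dots> \<le> 2 + ?B * (\<Sum>k\<le>m. real k * p k) + ?Q * ln (real m)"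
      using assms by (simp add: sum_nonneg)
    finally show ?case .
  next
    case (step t)
    have t: "real t > 0" using step assms by simp
    have "E (Suc t) \<le> E t + ?B * (real (Suc t) * p (Suc t)) + ?Q / real (Suc t)"
      unfolding E_def by (rule error_growth[OF assms(1,2) step(1) assms(4) stat])
    \<comment> \<open>Comparing with the increment of the logarithm makes the harmonic sum telescope.\<close>
    also have "?Q / real (Suc t) \<le> ?Q * (ln (real (Suc t)) - ln (real t))"
    proof -
      have "ln (real t / real (Suc t)) \<le> real t / real (Suc t) - 1"
        using t by (intro ln_le_minus_one) simp
      also have "\<dots> = - (1 / real (Suc t))" by (simp add: field_simps)
      finally have "1 / real (Suc t) \<le> ln (real (Suc t)) - ln (real t)"
        using t by (simp add: ln_div)
      from mult_left_mono[OF this, of ?Q] show ?thesis by simp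
    qed
    finally show ?case using step(3) by (simp add: algebra_simps)
  qed
  moreover have "(\<Sum>k\<le>t. real k * p k) \<le> real m"
  proof -
    have "(1 + \<epsilon>) * (\<Sum>k\<le>t. real k * p k) \<le> (1 + \<epsilon>) * real m"
    proof -
      have "0 \<le> (2 + \<epsilon>) * (real t + 1) * (1 - (\<Sum>k\<le>t. p k))"
        using tail(1)[of t] \<beta> by (intro mult_nonneg_nonneg) auto
      then show ?thesis using tail(2)[of t] by (simp add: algebra_simps)
    qed
    then show ?thesis using assms(2) by simp
  qed
  then have "?B * (\<Sum>k\<le>t. real k * p k) \<le> ?B * real m"
    using assms(2) by (intro mult_left_mono) auto
  ultimately show ?thesis unfolding E_def by linarith
qed

section \<open>Total variation distance\<close>

text \<open>
  Beyond \<open>N\<close> only \<open>M\<close> has mass, and it is what the states up to \<open>N\<close> leave over.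
\<close>

lemma dTV_le_sum_plus_tail:
  fixes P :: "nat pmf"
  assumes "prob_space M" "sets M = UNIV" and "\<And>k. k > N \<Longrightarrow> pmf P k = 0"
  shows "dTV (measure_pmf P) M
    \<le> (\<Sum>k\<le>N. \<bar>pmf P k - measure M {k}\<bar>) + (1 - (\<Sum>k\<le>N. measure M {k}))"
  unfolding dTV_def
proof (rule cSUP_least)
  interpret M: prob_space M by fact
  have space: "space M = UNIV" using sets_eq_imp_space_eq[of M "count_space UNIV"] assms(2) by simp
  fix A :: "nat set"
  have fin: "measure M B = (\<Sum>k\<in>B. measure M {k})" if "finite B" for B
    using that assms(2) by (intro M.finite_measure_eq_sum_singleton) auto
  have "measure_pmf.prob P A = measure_pmf.prob P (A \<inter> {..N})"
    using assms(3) by (intro measure_prob_cong_0) (auto simp: not_le)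
  then have PA: "measure_pmf.prob P A = (\<Sum>k\<in>A \<inter> {..N}. pmf P k)"
    by (simp add: measure_measure_pmf_finite)
  have "measure M A = measure M (A \<inter> {..N}) + measure M (A - {..N})"
    using assms(2) by (subst M.finite_measure_Union[symmetric]) (auto simp: Int_Diff_Un)
  then have MA: "measure M A = (\<Sum>k\<in>A \<inter> {..N}. measure M {k}) + measure M (A - {..N})"
    by (simp add: fin[of "A \<inter> {..N}"])
  have "measure M (A - {..N}) \<le> measure M (UNIV - {..N})"
    using assms(2) by (intro M.finite_measure_mono) auto
  also have "\<dots> = 1 - (\<Sum>k\<le>N. measure M {k})"
    using M.prob_compl[of "{..N}"] assms(2) by (simp add: space fin[of "{..N}"])
  finally have tail: "measure M (A - {..N}) \<le> 1 - (\<Sum>k\<le>N. measure M {k})" .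
  have "\<bar>(\<Sum>k\<in>A \<inter> {..N}. pmf P k) - (\<Sum>k\<in>A \<inter> {..N}. measure M {k})\<bar>
      \<le> (\<Sum>k\<in>A \<inter> {..N}. \<bar>pmf P k - measure M {k}\<bar>)"
    unfolding sum_subtractf[symmetric] by (rule sum_abs)
  also have "\<dots> \<le> (\<Sum>k\<le>N. \<bar>pmf P k - measure M {k}\<bar>)"
    by (intro sum_mono2) auto
  finally show "\<bar>measure_pmf.prob P A - measure M A\<bar>
      \<le> (\<Sum>k\<le>N. \<bar>pmf P k - measure M {k}\<bar>) + (1 - (\<Sum>k\<le>N. measure M {k}))"
    unfolding PA MA using tail measure_nonneg[of M "A - {..N}"] by linarith
qed simp

theorem theorem1p2:
  fixes m :: nat and \<delta> :: real
  assumes "m \<ge> 1" and "\<delta> > - real m"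
  shows "\<exists>C::real. \<forall>n::nat. n \<ge> 2 \<longrightarrow>
           dTV (measure_pmf (indegree_law m \<delta> n)) (K_dist m \<delta>) \<le> C * (ln (real n) / real n)"
proof -
  define \<epsilon> where "\<epsilon> = \<delta> / real m"
  define r where "r = real m * (1 + \<epsilon>)"
  define p where "p k = measure (K_dist m \<delta>) {k}" for k
  define Q where "Q = 2 * real m + 2 * real m ^ 2 + 2"
  define c where "c = 2 + (1 + real m + 1 / (1 + \<epsilon>)) * real m + Q * ln (real m) + r"
  have \<epsilon>: "\<epsilon> > -1" using assms by (simp add: \<epsilon>_def field_simps)
  have r: "r = real m + \<delta>" "r > 0" using assms by (simp_all add: r_def \<epsilon>_def distrib_left)
  have p0: "p k \<ge> 0" for k by (simp add: p_def)
  have stat: "birth_op r p k = (2 + \<epsilon>) * (p k - of_bool (k = 0))" for k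
    using K_dist_stationary[OF assms, of k] by (simp add: r(1) p_def[abs_def] \<epsilon>_def)
  have \<beta>: "2 + \<epsilon> > 1" using \<epsilon> by simp
  note tail = stationary_tail_and_mean[OF \<beta> r(2) p0 stat]
  have c0: "c \<ge> 0"
    using assms \<epsilon> r by (auto simp: c_def Q_def intro!: add_nonneg_nonneg mult_nonneg_nonneg)
  have "dTV (measure_pmf (indegree_law m \<delta> n)) (K_dist m \<delta>) \<le> (c / ln 2 + Q) * (ln (real n) / real n)"
    if n: "n \<ge> 2" for n
  proof -
    let ?N = "n * m"
    have N: "?N \<ge> m" "?N \<ge> n" "?N \<ge> 1" using n assms(1) by auto
    have P: "pmf (indegree_law m \<delta> n) k = mean_count m \<epsilon> ?N k / real n" for k
      unfolding \<epsilon>_def using n by (intro indegree_law_eq_mean_count assms(1)) simp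
    have "dTV (measure_pmf (indegree_law m \<delta> n)) (K_dist m \<delta>)
        \<le> (\<Sum>k\<le>?N. \<bar>pmf (indegree_law m \<delta> n) k - p k\<bar>) + (1 - (\<Sum>k\<le>?N. p k))"
      unfolding p_def using prob_space_K_dist[OF assms] sets_K_dist[OF assms]
    proof (rule dTV_le_sum_plus_tail)
      fix k assume "k > ?N"
      then show "pmf (indegree_law m \<delta> n) k = 0"
        unfolding P using \<epsilon> N by (simp add: mean_count_def group_law_support)
    qed
    also have "(\<Sum>k\<le>?N. \<bar>pmf (indegree_law m \<delta> n) k - p k\<bar>)
        = (\<Sum>k\<le>?N. \<bar>mean_count m \<epsilon> ?N k - real ?N / real m * p k\<bar>) / real n"
    proof -
      have "\<bar>pmf (indegree_law m \<delta> n) k - p k\<bar>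
          = \<bar>mean_count m \<epsilon> ?N k - real ?N / real m * p k\<bar> / real n" for k
      proof -
        have "pmf (indegree_law m \<delta> n) k - p k
            = (mean_count m \<epsilon> ?N k - real ?N / real m * p k) / real n"
          unfolding P using n assms(1) by (simp add: field_simps)
        then show ?thesis by simp
      qed
      then show ?thesis by (simp add: sum_divide_distrib)
    qed
    also have "\<dots> \<le> (2 + (1 + real m + 1 / (1 + \<epsilon>)) * real m + Q * ln (real ?N)) / real n"
      unfolding Q_def
      by (intro divide_right_mono error_log_bound assms(1) \<epsilon> N p0 stat[unfolded r_def]) simp
    also have "1 - (\<Sum>k\<le>?N. p k) \<le> r / real n"
    proof -
      let ?T = "1 - (\<Sum>k\<le>?N. p k)"
      have "real n \<le> real ?N + 1" using of_nat_mono[OF N(2), where 'a = real] by linarith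
      then have "1 * real n * ?T \<le> (2 + \<epsilon>) * (real ?N + 1) * ?T"
        using tail(1)[of ?N] \<beta> by (intro mult_right_mono mult_mono) auto
      also have "\<dots> \<le> r"
      proof -
        have "0 \<le> (2 + \<epsilon> - 1) * (\<Sum>k\<le>?N. real k * p k)"
          using \<beta> p0 by (intro mult_nonneg_nonneg sum_nonneg) auto
        then show ?thesis using tail(2)[of ?N] by linarith
      qed
      finally show ?thesis using n by (simp add: field_simps)
    qed
    also have "(2 + (1 + real m + 1 / (1 + \<epsilon>)) * real m + Q * ln (real ?N)) / real n + r / real n
        = (c + Q * ln (real n)) / real n"
      using n assms(1) by (simp add: c_def ln_mult algebra_simps add_divide_distrib)
    also have "\<dots> \<le> (c / ln 2 * ln (real n) + Q * ln (real n)) / real n"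
    proof (intro divide_right_mono add_right_mono)
      \<comment> \<open>The bounded contributions are absorbed into the logarithm, as \<open>n \<ge> 2\<close>.\<close>
      have "ln 2 \<le> ln (real n)" using n by simp
      from mult_left_mono[OF this c0] show "c \<le> c / ln 2 * ln (real n)"
        by (simp add: field_simps)
    qed simp
    also have "\<dots> = (c / ln 2 + Q) * (ln (real n) / real n)"
      by (simp add: distrib_right)
    finally show ?thesis by simp
  qed
  then show ?thesis by blast
qed

end
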